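(* Let $\Gamma$ be a bridgeless metrized graph with $v=\#V(\Gamma)$ vertices and let $k\ge1$ be an integer with $k+2\le v$. Then $$\tau(\Gamma)=\frac{(v-k-2)!}{(v-2)!}\sum_{e_{i_1}\in E(\Gamma)}\frac{R_{i_1}}{L_{i_1}+R_{i_1}}\sum_{e_{i_2}\in E(\overline{\Gamma}_{i_1})}\frac{R_{i_2}}{L_{i_2}+R_{i_2}}\cdots\sum_{e_{i_k}\in E(\overline{\Gamma}_{i_1,\dots,i_{k-1}})}\frac{R_{i_k}}{L_{i_k}+R_{i_k}}\,\tau(\overline{\Gamma}_{i_1,\dots,i_k})-\frac{k\,z(\Gamma)}{12(v-k-1)}.$$
   Context: A metrized graph is a finite connected graph (multiple edges and self-loops allowed) whose edges $e_j$ are identified with closed segments of lengths $L_j>0$; its vertex set is finite, nonempty, and contains all points of valence $\neq2$. For an edge $e_j$ of a metrized graph $G$, $G-e_j$ is $G$ with the interior of $e_j$ removed; $G$ is bridgeless if every $G-e_j$ is connected. $\overline{\Gamma}_{i_1}$ is obtained from $\Gamma$ by contracting the edge $e_{i_1}$ to a point, and inductively $\overline{\Gamma}_{i_1,\dots,i_k}$ is obtained from $\overline{\Gamma}_{i_1,\dots,i_{k-1}}$ by contracting its edge $e_{i_k}$ to a point (so $E(\overline{\Gamma}_{i_1,\dots,i_k})=E(\Gamma)\setminus\{e_{i_1},\dots,e_{i_k}\}$; multiple edges and loops may arise). In the sum over $e_{i_t}\in E(\overline{\Gamma}_{i_1,\dots,i_{t-1}})$, $R_{i_t}$ is the effective resistance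 between the endpoints of $e_{i_t}$ in $\overline{\Gamma}_{i_1,\dots,i_{t-1}}-e_{i_t}$ (edges are resistors with resistance equal to length); for a self-loop $R_{i_t}=0$. $z(\Gamma)=\sum_{e_j\in E(\Gamma)}\frac{L_j^2}{L_j+R_j}$. With $r(x,y)$ effective resistance, $\tau(G)=\frac14\int_G(\frac{\partial}{\partial x}r(x,y))^2dx$ (independent of $y$). *)

theory Defs
  imports "HOL-Analysis.Analysis" "Graph_Theory.Digraph_Component"
begin

text \<open>
  A metrized graph is given by a finite connected multigraph (loops and parallel edges allowed)
  and a positive length for each edge.  The tail and the head of an arc only fix an
  orientation of the undirected edge, i.e. from which end its points are parametrized;
  \<^const>\<open>Digraph_Component.connected\<close> refers to the underlying undirected graph and includes
  that the vertex set is nonempty.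
\<close>

locale metrized_graph = fin_digraph G for G :: "('a, 'b) pre_digraph" (structure) +
  fixes L :: "'b \<Rightarrow> real"
  assumes connected: "Digraph_Component.connected G"
    and length_pos: "e \<in> arcs G \<Longrightarrow> L e > 0"

definition bridgeless :: "('a, 'b) pre_digraph \<Rightarrow> bool" where
  "bridgeless G \<longleftrightarrow> (\<forall>e\<in>arcs G. Digraph_Component.connected (pre_digraph.del_arc G e))"

text \<open>
  The two endpoints of the contracted edge are merged into its tail.  Contracting a
  self-loop just deletes it.
\<close>

definition contract :: "('a, 'b) pre_digraph \<Rightarrow> 'b \<Rightarrow> ('a, 'b) pre_digraph" where
  "contract G e =
    (let q = (\<lambda>x. if x = head G e then tail G e else x)
     in \<lparr>verts = q ` verts G, arcs = arcs G - {e}, tail = q \<circ> tail G, head = q \<circ> head G\<rparr>)"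

text \<open>
  Kirchhoff's current law for the resistor network with resistances \<open>L e\<close>: the potential
  \<open>f\<close> drives a unit current that enters at \<open>p\<close> and leaves at \<open>q\<close>.  By Ohm's law the current
  through \<open>e\<close>, from tail to head, is the potential difference divided by \<open>L e\<close>.
\<close>

definition unit_current_potential ::
    "('a, 'b) pre_digraph \<Rightarrow> ('b \<Rightarrow> real) \<Rightarrow> 'a \<Rightarrow> 'a \<Rightarrow> ('a \<Rightarrow> real) \<Rightarrow> bool" where
  "unit_current_potential G L p q f \<longleftrightarrow>
    (\<forall>x\<in>verts G.
      (\<Sum>e | e \<in> arcs G \<and> tail G e = x. (f (tail G e) - f (head G e)) / L e)
      - (\<Sum>e | e \<in> arcs G \<and> head G e = x. (f (tail G e) - f (head G e)) / L e)
      = of_bool (x = p) - of_bool (x = q))"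

definition eff_resistance ::
    "('a, 'b) pre_digraph \<Rightarrow> ('b \<Rightarrow> real) \<Rightarrow> 'a \<Rightarrow> 'a \<Rightarrow> real" where
  "eff_resistance G L p q = (THE r. \<exists>f. unit_current_potential G L p q f \<and> r = f p - f q)"

definition edge_resistance :: "('a, 'b) pre_digraph \<Rightarrow> ('b \<Rightarrow> real) \<Rightarrow> 'b \<Rightarrow> real" where
  "edge_resistance G L e = eff_resistance (pre_digraph.del_arc G e) L (tail G e) (head G e)"

definition z_invariant :: "('a, 'b) pre_digraph \<Rightarrow> ('b \<Rightarrow> real) \<Rightarrow> real" where
  "z_invariant G L = (\<Sum>e\<in>arcs G. (L e)\<^sup>2 / (L e + edge_resistance G L e))"

text \<open>
  Points of the metrized graph: \<open>Inner e t\<close> is the point in the interior of \<open>e\<close> at distance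
  \<open>t\<close>, measured along \<open>e\<close>, from the tail of \<open>e\<close>.
\<close>

datatype ('a, 'b) point = Vertex 'a | Inner 'b real

definition points :: "('a, 'b) pre_digraph \<Rightarrow> ('b \<Rightarrow> real) \<Rightarrow> ('a, 'b) point set" where
  "points G L = Vertex ` verts G \<union> {Inner e t |e t. e \<in> arcs G \<and> 0 < t \<and> t < L e}"

definition edge_point ::
    "('a, 'b) pre_digraph \<Rightarrow> ('b \<Rightarrow> real) \<Rightarrow> 'b \<Rightarrow> real \<Rightarrow> ('a, 'b) point" where
  "edge_point G L e t =
    (if t \<le> 0 then Vertex (tail G e) else if L e \<le> t then Vertex (head G e) else Inner e t)"

text \<open>
  The same metrized graph with the points in \<open>S\<close> added to the vertex set.  Its edges are the
  segments \<open>(e, s, t)\<close> of \<open>e\<close> between consecutive positions \<open>s < t\<close> of vertices on \<open>e\<close>.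
\<close>

definition cut_positions :: "('b \<Rightarrow> real) \<Rightarrow> ('a, 'b) point set \<Rightarrow> 'b \<Rightarrow> real set" where
  "cut_positions L S e = {0, L e} \<union> {t. Inner e t \<in> S}"

definition subdivide ::
    "('a, 'b) pre_digraph \<Rightarrow> ('b \<Rightarrow> real) \<Rightarrow> ('a, 'b) point set
      \<Rightarrow> (('a, 'b) point, 'b \<times> real \<times> real) pre_digraph" where
  "subdivide G L S =
    \<lparr>verts = Vertex ` verts G \<union> S,
     arcs = {(e, s, t). e \<in> arcs G \<and> s \<in> cut_positions L S e \<and> t \<in> cut_positions L S e \<and> s < t \<and>
               (\<forall>u\<in>cut_positions L S e. \<not> (s < u \<and> u < t))},
     tail = (\<lambda>(e, s, t). edge_point G L e s),
     head = (\<lambda>(e, s, t). edge_point G L e t)\<rparr>"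

text \<open>
  The resistance function \<open>r(x, y)\<close> on the metrized graph.
\<close>

definition resistance ::
    "('a, 'b) pre_digraph \<Rightarrow> ('b \<Rightarrow> real) \<Rightarrow> ('a, 'b) point \<Rightarrow> ('a, 'b) point \<Rightarrow> real" where
  "resistance G L x y = eff_resistance (subdivide G L {x, y}) (\<lambda>(e, s, t). t - s) x y"

text \<open>
  The derivative along an edge exists except at finitely many points, and the orientation of
  the edge does not affect its square.  The value of \<open>tau_at G L y\<close> does not depend on the
  point \<open>y\<close>; in \<open>tau\<close> an arbitrary point is chosen.
\<close>

definition tau_at ::
    "('a, 'b) pre_digraph \<Rightarrow> ('b \<Rightarrow> real) \<Rightarrow> ('a, 'b) point \<Rightarrow> real" where
  "tau_at G L y =
    1/4 * (\<Sum>e\<in>arcs G.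
      integral {0..L e} (\<lambda>t. (deriv (\<lambda>s. resistance G L (edge_point G L e s) y) t)\<^sup>2))"

definition tau :: "('a, 'b) pre_digraph \<Rightarrow> ('b \<Rightarrow> real) \<Rightarrow> real" where
  "tau G L = tau_at G L (SOME y. y \<in> points G L)"

text \<open>
  The \<open>k\<close>-fold nested sum over successively contracted edges, with \<^const>\<open>tau\<close> of the final
  contraction as innermost factor.
\<close>

primrec contraction_sum :: "('b \<Rightarrow> real) \<Rightarrow> nat \<Rightarrow> ('a, 'b) pre_digraph \<Rightarrow> real" where
  "contraction_sum L 0 G = tau G L"
| "contraction_sum L (Suc k) G =
    (\<Sum>e\<in>arcs G. edge_resistance G L e / (L e + edge_resistance G L e)
                   * contraction_sum L k (contract G e))"

end

theory Submission
  imports Defs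
begin

text \<open>
  Fix a vertex \<open>b\<close>, let \<open>u x = r(x, b)\<close>, let \<open>\<rho> e\<close> be the effective resistance in \<open>G\<close> (with \<open>e\<close>
  included) between the ends of \<open>e\<close>, and write \<open>d\<close> for the difference along an edge.  Then
  \<open>R / (L + R) = \<rho> / L\<close>, and integrating the quadratic polynomials \<open>r(-, y)\<close> over the edges gives
  \<open>12 tau(G) = (\<Sum>f. (3 (du f)\<^sup>2 + (L f - \<rho> f)\<^sup>2) / L f)\<close> for every base point \<open>y\<close>, because
  \<open>r(x, y) = k(x) + k(y) - 2 K(x, y)\<close> with \<open>K\<close> the Green function grounded at \<open>b\<close> and \<open>k\<close> its diagonal,
  and the terms with \<open>K\<close> contribute \<open>- 4 k(y) + 4 k(y)\<close>.

  Let \<open>h\<close> be the potential, zero at \<open>b\<close>, of a unit current between the ends of \<open>e\<close>.  Contracting \<open>e\<close>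
  replaces \<open>u\<close> by \<open>u - h\<^sup>2 / \<rho> e\<close> and \<open>\<rho> f\<close> by \<open>\<rho> f - (dh f)\<^sup>2 / \<rho> e\<close>.  In the sum of
  \<open>\<rho> e / L e * tau(G / e)\<close> over \<open>e\<close>, the leading terms are evaluated by Foster's theorem
  \<open>(\<Sum>e. \<rho> e / L e) = v - 1\<close>, the mixed terms by \<open>(\<Sum>e. h\<^sup>2 / L e) = u\<close>, and the quartic terms by testing
  the current of \<open>h\<close> against \<open>h\<^sup>3\<close>.  The result is \<open>(v - 2) tau(G) + z(G) / 12\<close>; in the same way \<open>z\<close>
  yields \<open>(v - 1) z(G)\<close>, and the theorem follows by induction on \<open>k\<close>.
\<close>

section \<open>Resistor networks\<close>

definition grad :: "('a, 'b) pre_digraph \<Rightarrow> ('a \<Rightarrow> real) \<Rightarrow> 'b \<Rightarrow> real" where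
  "grad G f e = f (tail G e) - f (head G e)"

lemma grad_linear [simp]:
  "grad G (\<lambda>x. f x + g x) e = grad G f e + grad G g e"
  "grad G (\<lambda>x. f x - g x) e = grad G f e - grad G g e"
  "grad G (\<lambda>x. c * f x) e = c * grad G f e"
  "grad G (\<lambda>x. f x * c) e = grad G f e * c"
  "grad G (\<lambda>x. f x / c) e = grad G f e / c"
  "grad G (\<lambda>x. c) e = 0"
  by (auto simp: grad_def algebra_simps diff_divide_distrib)

text \<open>The Dirichlet form of the network. Pairing with arbitrary \<open>w\<close> is the weak
  form of Kirchhoff's law, which is linear and needs no sums at single vertices.\<close>

definition energy :: "('a, 'b) pre_digraph \<Rightarrow> ('b \<Rightarrow> real) \<Rightarrow> ('a \<Rightarrow> real) \<Rightarrow> ('a \<Rightarrow> real) \<Rightarrow> real" where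
  "energy G L w f = (\<Sum>e\<in>arcs G. grad G w e * grad G f e / L e)"

lemma energy_commute: "energy G L w f = energy G L f w"
  by (simp add: energy_def mult.commute)

lemma energy_linear:
  "energy G L w (\<lambda>x. f x + g x) = energy G L w f + energy G L w g"
  "energy G L w (\<lambda>x. f x - g x) = energy G L w f - energy G L w g"
  "energy G L w (\<lambda>x. c * f x) = c * energy G L w f"
  "energy G L w (\<lambda>x. c) = 0"
  "energy G L (\<lambda>x. v x + w x) f = energy G L v f + energy G L w f"
  "energy G L (\<lambda>x. v x - w x) f = energy G L v f - energy G L w f"
  "energy G L (\<lambda>x. c * w x) f = c * energy G L w f"
  by (auto simp: energy_def algebra_simps sum.distrib sum_subtractf sum_distrib_left
      add_divide_distrib diff_divide_distrib intro!: sum.cong)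

text \<open>
  The analytic form of connectedness assumed here passes to contractions and subdivisions by
  composing functions, without any walks.
\<close>

locale network = fin_digraph G for G :: "('a, 'b) pre_digraph" (structure) +
  fixes L :: "'b \<Rightarrow> real"
  assumes verts_nonempty: "verts G \<noteq> {}"
    and length_pos: "e \<in> arcs G \<Longrightarrow> L e > 0"
    and grad_zero_imp_eq:
      "(\<And>e. e \<in> arcs G \<Longrightarrow> grad G f e = 0) \<Longrightarrow> x \<in> verts G \<Longrightarrow> y \<in> verts G \<Longrightarrow> f x = f y"

lemma connected_grad_zero_imp_eq:
  assumes conn: "Digraph_Component.connected G"
    and grad0: "\<And>e. e \<in> arcs G \<Longrightarrow> grad G f e = 0"
    and "x \<in> verts G" "y \<in> verts G"
  shows "f x = f y"
proof -
  have "(x, y) \<in> (arcs_ends (with_proj (mk_symmetric G)))\<^sup>*"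
    using assms by (intro reachable_rtranclI) (auto simp: Digraph_Component.connected_def strongly_connected_def)
  then show ?thesis
  proof (induct rule: rtrancl_induct)
    case (step a b)
    then show ?case
      using grad0 by (force simp: parcs_mk_symmetric grad_def)
  qed simp
qed

lemma (in metrized_graph) network: "network G L"
proof
  show "verts G \<noteq> {}"
    using connected by (auto simp: Digraph_Component.connected_def strongly_connected_def)
qed (use length_pos connected_grad_zero_imp_eq[OF connected] in blast)+

lemma (in metrized_graph) network_del_arc:
  assumes "Digraph_Component.connected (del_arc e)"
  shows "network (del_arc e) L"
proof -
  interpret H: fin_digraph "del_arc e"
    by (rule fin_digraph_del_arc)
  show ?thesis
  proof
    show "verts (del_arc e) \<noteq> {}"
      using connected by (auto simp: Digraph_Component.connected_def strongly_connected_def)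
  qed (use length_pos connected_grad_zero_imp_eq[OF assms] in auto)
qed

context network
begin

lemma energy_nonneg: "energy G L f f \<ge> 0"
  unfolding energy_def using length_pos by (intro sum_nonneg) (auto simp: less_imp_le)

lemma energy_eq_0_imp_eq:
  assumes "energy G L f f = 0" "x \<in> verts G" "y \<in> verts G"
  shows "f x = f y"
proof (rule grad_zero_imp_eq[OF _ assms(2,3)])
  fix e assume e: "e \<in> arcs G"
  have "\<forall>e\<in>arcs G. grad G f e * grad G f e / L e = 0"
    using assms(1) length_pos
    by (subst sum_nonneg_eq_0_iff[symmetric]) (auto simp: energy_def less_imp_le)
  then show "grad G f e = 0"
    using e length_pos by force
qed

lemma energy_cong:
  assumes "\<And>x. x \<in> verts G \<Longrightarrow> f x = f' x" "\<And>x. x \<in> verts G \<Longrightarrow> w x = w' x"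
  shows "energy G L w f = energy G L w' f'"
  unfolding energy_def grad_def using assms by (intro sum.cong) auto

text \<open>Summation by parts: the bracket is the net current of \<open>f\<close> leaving
  \<open>x\<close>.\<close>

lemma energy_eq_sum_verts:
  "energy G L w f = (\<Sum>x\<in>verts G. w x *
     ((\<Sum>e | e \<in> arcs G \<and> tail G e = x. grad G f e / L e)
      - (\<Sum>e | e \<in> arcs G \<and> head G e = x. grad G f e / L e)))"
proof -
  have part: "(\<Sum>x\<in>verts G. w x * (\<Sum>e | e \<in> arcs G \<and> h e = x. grad G f e / L e))
      = (\<Sum>e\<in>arcs G. w (h e) * (grad G f e / L e))"
    if "\<And>e. e \<in> arcs G \<Longrightarrow> h e \<in> verts G" for h :: "'b \<Rightarrow> 'a"
  proof -
    have "(\<Sum>x\<in>verts G. w x * (\<Sum>e | e \<in> arcs G \<and> h e = x. grad G f e / L e))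
        = (\<Sum>x\<in>verts G. \<Sum>e | e \<in> arcs G \<and> h e = x. w (h e) * (grad G f e / L e))"
      by (auto simp: sum_distrib_left intro!: sum.cong)
    also have "\<dots> = (\<Sum>e\<in>arcs G. w (h e) * (grad G f e / L e))"
      using that by (intro sum.group) auto
    finally show ?thesis .
  qed
  show ?thesis
    unfolding right_diff_distrib sum_subtractf
    by (simp add: part energy_def grad_def[of G w] sum_subtractf[symmetric] left_diff_distrib
        diff_divide_distrib)
qed

lemma unit_current_potential_iff:
  assumes "p \<in> verts G" "q \<in> verts G"
  shows "unit_current_potential G L p q f \<longleftrightarrow> (\<forall>w. energy G L w f = w p - w q)"
proof
  assume f: "unit_current_potential G L p q f"
  show "\<forall>w. energy G L w f = w p - w q"
  proof
    fix w
    have "energy G L w f = (\<Sum>x\<in>verts G. w x * (of_bool (x = p) - of_bool (x = q)))"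
      unfolding energy_eq_sum_verts grad_def
      using f by (intro sum.cong) (auto simp: unit_current_potential_def)
    then show "energy G L w f = w p - w q"
      using assms by (simp add: right_diff_distrib sum_subtractf)
  qed
next
  assume *: "\<forall>w. energy G L w f = w p - w q"
  show "unit_current_potential G L p q f"
    unfolding unit_current_potential_def
  proof
    fix x assume x: "x \<in> verts G"
    have "energy G L (\<lambda>y. of_bool (y = x)) f
      = (\<Sum>e | e \<in> arcs G \<and> tail G e = x. grad G f e / L e)
        - (\<Sum>e | e \<in> arcs G \<and> head G e = x. grad G f e / L e)"
      unfolding energy_eq_sum_verts using x
      by (subst sum.remove[of _ x]) (auto intro!: sum.neutral)
    then show "(\<Sum>e | e \<in> arcs G \<and> tail G e = x. (f (tail G e) - f (head G e)) / L e)
        - (\<Sum>e | e \<in> arcs G \<and> head G e = x. (f (tail G e) - f (head G e)) / L e)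
        = of_bool (x = p) - of_bool (x = q)"
      using * by (simp add: grad_def eq_commute)
  qed
qed

text \<open>Uniqueness justifies the \<open>THE\<close>: the difference of two such potentials has
  zero energy, hence is constant on the vertices.\<close>

lemma eff_resistance_eqI:
  assumes p: "p \<in> verts G" and q: "q \<in> verts G"
    and f: "\<And>w. energy G L w f = w p - w q"
  shows "eff_resistance G L p q = f p - f q"
  unfolding eff_resistance_def
proof (rule the_equality)
  show "\<exists>g. unit_current_potential G L p q g \<and> f p - f q = g p - g q"
    using unit_current_potential_iff[OF p q] f by blast
next
  fix r assume "\<exists>g. unit_current_potential G L p q g \<and> r = g p - g q"
  then obtain g where g: "\<And>w. energy G L w g = w p - w q" and r: "r = g p - g q"
    using unit_current_potential_iff[OF p q] by blast
  have "energy G L (\<lambda>x. f x - g x) (\<lambda>x. f x - g x) = 0"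
    by (simp add: energy_linear(2) f g)
  from energy_eq_0_imp_eq[OF this p q] show "r = f p - f q"
    using r by simp
qed

text \<open>
  Gram-Schmidt: in the induction step, \<open>n\<close> is the indicator of the new vertex made orthogonal to
  the functions that vanish outside the old set.
\<close>

lemma energy_representation:
  assumes "finite S" "S \<subseteq> verts G - {b}" and b: "b \<in> verts G"
  shows "\<exists>f. (\<forall>x. x \<notin> S \<longrightarrow> f x = 0) \<and>
    (\<forall>w. (\<forall>x. x \<notin> S \<longrightarrow> w x = 0) \<longrightarrow> energy G L w f = (\<Sum>x\<in>S. w x * l x))"
  using assms(1,2)
proof (induction S arbitrary: l)
  case empty
  have "energy G L w (\<lambda>x. 0) = 0" for w
    by (simp add: energy_linear)
  then show ?case by auto
next
  case (insert s S)
  let ?on = "\<lambda>S w. \<forall>x. x \<notin> S \<longrightarrow> w x = (0::real)"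
  let ?d = "\<lambda>x. of_bool (x = s) :: real"
  have S: "S \<subseteq> verts G - {b}" and sV: "s \<in> verts G" and sb: "s \<noteq> b"
    using insert.prems by auto
  obtain h where h: "?on S h" "\<And>w. ?on S w \<Longrightarrow> energy G L w h = (\<Sum>x\<in>S. w x * l x)"
    using insert.IH[OF S, of l] by blast
  \<comment> \<open>\<open>m\<close> encodes the pairing with the indicator of \<open>s\<close>, so
    \<open>k\<close> is the energy projection of that indicator onto the old functions.\<close>
  define m where "m = (\<lambda>x. energy G L (\<lambda>y. of_bool (y = x)) ?d)"
  obtain k where k: "?on S k" "\<And>w. ?on S w \<Longrightarrow> energy G L w k = (\<Sum>x\<in>S. w x * m x)"
    using insert.IH[OF S, of m] by blast
  have expand: "energy G L w ?d = (\<Sum>x\<in>S. w x * m x)" if "?on S w" for w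
  proof -
    have "w = (\<lambda>y. \<Sum>x\<in>S. w x * of_bool (y = x))"
    proof
      fix y
      show "w y = (\<Sum>x\<in>S. w x * of_bool (y = x))"
        using that insert.hyps(1) by (cases "y \<in> S") (auto simp: of_bool_def if_distrib cong: if_cong)
    qed
    moreover have "energy G L (\<lambda>y. \<Sum>x\<in>T. w x * of_bool (y = x)) ?d = (\<Sum>x\<in>T. w x * m x)"
      if "finite T" for T
      using that
    proof (induction T)
      case empty
      then show ?case by (simp add: energy_commute[of _ _ "\<lambda>x. 0"] energy_linear(4))
    next
      case (insert x T)
      then show ?case by (simp add: energy_linear m_def del: sum_mult_of_bool_eq)
    qed
    ultimately show ?thesis using insert.hyps(1) by metis
  qed
  define n where "n = (\<lambda>x. ?d x - k x)"
  have n_orth: "energy G L w n = 0" if "?on S w" for w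
    unfolding n_def energy_linear(2) using expand[OF that] k(2)[OF that] by simp
  have ns: "n s = 1" using insert.hyps(2) k(1) by (simp add: n_def)
  have nb: "n b = 0" using S k(1) sb by (auto simp: n_def)
  have nn: "energy G L n n \<noteq> 0"
    using energy_eq_0_imp_eq[OF _ sV b, of n] ns nb by auto
  have n_on: "?on (insert s S) n" using k(1) by (auto simp: n_def)
  \<comment> \<open>The value of \<open>c\<close> is forced by testing the representation with
    \<open>n\<close>.\<close>
  define c where "c = ((\<Sum>x\<in>insert s S. n x * l x) - energy G L n h) / energy G L n n"
  show ?case
  proof (intro exI[of _ "\<lambda>x. h x + c * n x"] conjI allI impI)
    fix x assume "x \<notin> insert s S"
    then show "h x + c * n x = 0" using h(1) n_on by simp
  next
    fix w assume w: "?on (insert s S) w"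
    define w' where "w' = (\<lambda>x. w x - w s * n x)"
    have w': "?on S w'"
    proof (intro allI impI)
      fix x assume "x \<notin> S"
      then show "w' x = 0"
        using w n_on ns by (cases "x = s") (auto simp: w'_def)
    qed
    have w_eq: "w = (\<lambda>x. w' x + w s * n x)" by (auto simp: w'_def)
    have "energy G L w (\<lambda>x. h x + c * n x)
      = energy G L w' h + w s * energy G L n h + c * (w s * energy G L n n)"
      by (subst w_eq) (simp add: energy_linear n_orth[OF w'] distrib_left)
    also have "\<dots> = (\<Sum>x\<in>S. w' x * l x) + w s * (\<Sum>x\<in>insert s S. n x * l x)"
      using nn by (simp add: h(2)[OF w'] c_def field_simps)
    also have "(\<Sum>x\<in>S. w' x * l x) = (\<Sum>x\<in>insert s S. w' x * l x)"
      using insert.hyps w' by simp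
    also have "\<dots> + w s * (\<Sum>x\<in>insert s S. n x * l x) = (\<Sum>x\<in>insert s S. w x * l x)"
      unfolding sum_distrib_left sum.distrib[symmetric]
      by (intro sum.cong) (auto simp: w'_def algebra_simps)
    finally show "energy G L w (\<lambda>x. h x + c * n x) = (\<Sum>x\<in>insert s S. w x * l x)" .
  qed
qed

text \<open>Evaluation at \<open>z\<close> is represented on the functions vanishing at
  \<open>b\<close>; a general \<open>w\<close> reduces to these by subtracting the constant
  \<open>w b\<close>, which the energy ignores.\<close>

lemma Green_function_exists:
  assumes b: "b \<in> verts G"
  shows "\<exists>g. (\<forall>z. g z b = 0) \<and> (\<forall>z\<in>verts G. \<forall>w. energy G L w (g z) = w z - w b)"
proof -
  have "\<exists>f. f b = 0 \<and> (\<forall>w. energy G L w f = w z - w b)" if z: "z \<in> verts G" for z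
  proof -
    let ?S = "verts G - {b}"
    obtain f where f: "\<forall>x. x \<notin> ?S \<longrightarrow> f x = 0"
      "\<And>w. (\<forall>x. x \<notin> ?S \<longrightarrow> w x = 0) \<Longrightarrow> energy G L w f = (\<Sum>x\<in>?S. w x * of_bool (x = z))"
      using energy_representation[OF _ _ b, of ?S "\<lambda>x. of_bool (x = z)"] by auto
    have "energy G L w f = w z - w b" for w
    proof -
      define w' where "w' = (\<lambda>x. if x \<in> verts G then w x - w b else 0)"
      have "energy G L w f = energy G L w' f"
        unfolding energy_def
        by (intro sum.cong) (auto simp: grad_def w'_def)
      also have "\<dots> = (\<Sum>x\<in>?S. w' x * of_bool (x = z))"
        by (rule f(2)) (auto simp: w'_def)
      also have "\<dots> = w z - w b"
        using z by (auto simp: w'_def of_bool_def if_distrib cong: if_cong)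
      finally show ?thesis .
    qed
    then show ?thesis using f(1) by blast
  qed
  then obtain g where "\<And>z. z \<in> verts G \<Longrightarrow> g z b = 0 \<and> (\<forall>w. energy G L w (g z) = w z - w b)"
    by metis
  then show ?thesis
    by (intro exI[of _ "\<lambda>z. if z \<in> verts G then g z else (\<lambda>x. 0)"]) auto
qed

end

section \<open>Grounded Green functions\<close>

text \<open>\<open>g z\<close> is the potential, grounded at \<open>b\<close>, of a unit current
  from \<open>z\<close> to \<open>b\<close>; \<open>g\<close> is the reproducing kernel of the
  energy form on functions vanishing at \<open>b\<close>.\<close>

locale grounded_network = network +
  fixes b :: 'a and g :: "'a \<Rightarrow> 'a \<Rightarrow> real"
  assumes base_in_verts: "b \<in> verts G"
    and Green_base: "z \<in> verts G \<Longrightarrow> g z b = 0"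
    and energy_Green: "z \<in> verts G \<Longrightarrow> energy G L w (g z) = w z - w b"

lemma (in network) obtain_grounded:
  assumes "b \<in> verts G"
  obtains g where "grounded_network G L b g"
proof -
  obtain g where "\<forall>z. g z b = 0" "\<forall>z\<in>verts G. \<forall>w. energy G L w (g z) = w z - w b"
    using Green_function_exists[OF assms] by blast
  then have "grounded_network G L b g"
    using assms by unfold_locales auto
  then show thesis by (rule that)
qed

context grounded_network
begin

text \<open>Reciprocity: both values are the energy pairing of \<open>g x\<close> with
  \<open>g y\<close>.\<close>

lemma Green_commute: "x \<in> verts G \<Longrightarrow> y \<in> verts G \<Longrightarrow> g x y = g y x"
  using energy_Green[of x "g y"] energy_Green[of y "g x"] energy_commute[of G L "g x" "g y"]
  by (simp add: Green_base)

text \<open>The grounded potential of a unit current from the tail to the head of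
  \<open>e\<close>.\<close>

definition dipole :: "'b \<Rightarrow> 'a \<Rightarrow> real" where
  "dipole e x = g (tail G e) x - g (head G e) x"

text \<open>Effective resistance between the ends of \<open>e\<close> with \<open>e\<close> itself
  kept, unlike \<open>edge_resistance\<close>.\<close>

definition rho :: "'b \<Rightarrow> real" where
  "rho e = grad G (dipole e) e"

lemma dipole_base: "e \<in> arcs G \<Longrightarrow> dipole e b = 0"
  by (simp add: dipole_def Green_base)

lemma energy_dipole: "e \<in> arcs G \<Longrightarrow> energy G L w (dipole e) = grad G w e"
  unfolding dipole_def[abs_def] energy_linear by (simp add: energy_Green grad_def)

lemma energy_dipole_left: "e \<in> arcs G \<Longrightarrow> energy G L (dipole e) w = grad G w e"
  by (subst energy_commute) (rule energy_dipole)

lemma dipole_eq_grad_Green: "e \<in> arcs G \<Longrightarrow> x \<in> verts G \<Longrightarrow> dipole e x = grad G (g x) e"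
  using Green_commute by (simp add: dipole_def grad_def)

lemma grad_dipole_commute:
  "e \<in> arcs G \<Longrightarrow> f \<in> arcs G \<Longrightarrow> grad G (dipole e) f = grad G (dipole f) e"
  using energy_dipole[of f "dipole e"] energy_dipole_left[of e "dipole f"] by simp

lemma eff_resistance_eq_rho:
  assumes "e \<in> arcs G"
  shows "eff_resistance G L (tail G e) (head G e) = rho e"
  using assms energy_dipole[OF assms]
  by (subst eff_resistance_eqI[of _ _ "dipole e"]) (auto simp: rho_def grad_def)

lemma rho_eq_energy: "e \<in> arcs G \<Longrightarrow> rho e = energy G L (dipole e) (dipole e)"
  by (simp add: energy_dipole rho_def)

lemma rho_loop: "tail G e = head G e \<Longrightarrow> rho e = 0"
  by (simp add: rho_def grad_def)

text \<open>A dipole of zero energy would be constant and drive no current, but the indicator of the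
  tail detects a unit current.\<close>

lemma rho_pos:
  assumes e: "e \<in> arcs G" and "tail G e \<noteq> head G e"
  shows "rho e > 0"
proof -
  have "energy G L (dipole e) (dipole e) \<noteq> 0"
  proof
    assume *: "energy G L (dipole e) (dipole e) = 0"
    let ?d = "\<lambda>x. of_bool (x = tail G e) :: real"
    have "energy G L ?d (dipole e) = energy G L ?d (\<lambda>_. dipole e b)"
      using energy_eq_0_imp_eq[OF * _ base_in_verts] by (intro energy_cong) auto
    then have "grad G ?d e = 0"
      using energy_dipole[OF e] by (simp add: energy_linear(4))
    then show False
      using assms(2) by (simp add: grad_def)
  qed
  then show ?thesis
    using energy_nonneg[of "dipole e"] rho_eq_energy[OF e] by simp
qed

text \<open>A Parseval identity: by reciprocity \<open>dipole e x\<close> is the drop of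
  \<open>g x\<close> along \<open>e\<close>, so the sum is the energy of \<open>g x\<close>, which
  reproduces its value at \<open>x\<close>.\<close>

lemma sum_dipole_squares:
  assumes "x \<in> verts G"
  shows "(\<Sum>e\<in>arcs G. (dipole e x)\<^sup>2 / L e) = g x x"
proof -
  have "(\<Sum>e\<in>arcs G. (dipole e x)\<^sup>2 / L e) = energy G L (g x) (g x)"
    unfolding energy_def
    using assms by (intro sum.cong) (auto simp: dipole_eq_grad_Green power2_eq_square)
  then show ?thesis
    by (simp add: energy_Green Green_base assms)
qed

lemma sum_grad_dipole_squares:
  assumes f: "f \<in> arcs G"
  shows "(\<Sum>e\<in>arcs G. (grad G (dipole e) f)\<^sup>2 / L e) = rho f"
  unfolding rho_eq_energy[OF f] energy_def
  using grad_dipole_commute[OF f] by (intro sum.cong) (auto simp: power2_eq_square)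

lemma sum_grad_dipole_square:
  assumes f: "f \<in> arcs G"
  shows "(\<Sum>e\<in>arcs G. grad G (\<lambda>x. (dipole e x)\<^sup>2) f / L e) = grad G (\<lambda>x. g x x) f"
proof -
  have "(\<Sum>e\<in>arcs G. grad G (\<lambda>x. (dipole e x)\<^sup>2) f / L e)
    = (\<Sum>e\<in>arcs G. (dipole e (tail G f))\<^sup>2 / L e) - (\<Sum>e\<in>arcs G. (dipole e (head G f))\<^sup>2 / L e)"
    by (simp add: grad_def diff_divide_distrib sum_subtractf)
  then show ?thesis
    using f by (simp add: sum_dipole_squares grad_def)
qed

text \<open>A trace computation: the dipole is a combination of the \<open>g z\<close> with the
  drops of vertex indicators as coefficients. Exchanging the sums leaves the energy pairing of the
  indicator of \<open>z\<close> with \<open>g z\<close>, which is 1 for \<open>z\<close> other than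
  \<open>b\<close> and 0 for \<open>z = b\<close>.\<close>

lemma Foster: "(\<Sum>e\<in>arcs G. rho e / L e) = real (card (verts G)) - 1"
proof -
  have delta: "(\<Sum>z\<in>verts G. of_bool (x = z) * c z) = c x" if "x \<in> verts G"
    for x and c :: "'a \<Rightarrow> real"
    using that by simp
  have "rho e / L e = (\<Sum>z\<in>verts G. grad G (\<lambda>x. of_bool (x = z)) e * grad G (g z) e / L e)"
    if e: "e \<in> arcs G" for e
  proof -
    have "(\<Sum>z\<in>verts G. grad G (\<lambda>x. of_bool (x = z)) e * grad G (g z) e)
      = (\<Sum>z\<in>verts G. of_bool (tail G e = z) * grad G (g z) e)
        - (\<Sum>z\<in>verts G. of_bool (head G e = z) * grad G (g z) e)"
      unfolding grad_def[of G "\<lambda>x. of_bool (x = _)"] left_diff_distrib sum_subtractf ..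
    also have "\<dots> = rho e"
      using e by (simp only: delta tail_in_verts head_in_verts) (simp add: rho_def grad_def dipole_def)
    finally show ?thesis
      by (simp add: sum_divide_distrib[symmetric])
  qed
  then have "(\<Sum>e\<in>arcs G. rho e / L e)
    = (\<Sum>e\<in>arcs G. \<Sum>z\<in>verts G. grad G (\<lambda>x. of_bool (x = z)) e * grad G (g z) e / L e)"
    by simp
  also have "\<dots> = (\<Sum>z\<in>verts G. energy G L (\<lambda>x. of_bool (x = z)) (g z))"
    unfolding energy_def by (rule sum.swap)
  also have "\<dots> = (\<Sum>z\<in>verts G. 1 - of_bool (b = z) * 1)"
    by (intro sum.cong) (simp_all add: energy_Green)
  also have "\<dots> = real (card (verts G)) - 1"
    unfolding sum_subtractf delta[OF base_in_verts] by simp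
  finally show ?thesis .
qed

text \<open>The parallel law: \<open>e\<close> in parallel with the rest of the network, of
  resistance \<open>R\<close>, gives \<open>rho e = R * L e / (L e + R)\<close>.\<close>

lemma edge_resistance_rho:
  assumes e: "e \<in> arcs G" and N: "network (del_arc e) L"
  shows "edge_resistance G L e / (L e + edge_resistance G L e) = rho e / L e" (is ?A)
    and "(L e)\<^sup>2 / (L e + edge_resistance G L e) = L e - rho e" (is ?B)
proof -
  interpret N: network "del_arc e" L by (rule N)
  let ?a = "tail G e" and ?h = "head G e"
  have a: "?a \<in> verts (del_arc e)" and h: "?h \<in> verts (del_arc e)"
    using e by auto
  obtain f where f: "\<And>w. energy (del_arc e) L w f = w ?a - w ?h"
    using N.Green_function_exists[OF h] a by blast
  define R where "R = f ?a - f ?h"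
  have R: "edge_resistance G L e = R"
    unfolding edge_resistance_def R_def by (rule N.eff_resistance_eqI[OF a h f])
  have R0: "R \<ge> 0"
    using N.energy_nonneg[of f] by (simp add: f R_def)
  have L0: "L e > 0" using e by (rule length_pos)
  \<comment> \<open>Restoring \<open>e\<close> lets \<open>f\<close> drive an additional current
    \<open>R / L e\<close> through it, so \<open>f\<close> has to be divided by
    \<open>1 + R / L e\<close>.\<close>
  have en: "energy G L w f = (w ?a - w ?h) * (1 + R / L e)" for w
  proof -
    have "energy G L w f = energy (del_arc e) L w f + grad G w e * grad G f e / L e"
      unfolding energy_def using e by (simp add: sum.remove[of _ e] grad_def)
    then show ?thesis by (simp add: f R_def grad_def distrib_left)
  qed
  have "energy G L w (\<lambda>x. (1 / (1 + R / L e)) * f x) = w ?a - w ?h" for w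
  proof -
    have "1 + R / L e > 0" using R0 L0 by (simp add: add_pos_nonneg)
    then show ?thesis unfolding energy_linear(3) en by simp
  qed
  from eff_resistance_eqI[OF _ _ this]
  have "rho e = (1 / (1 + R / L e)) * R"
    using e by (simp add: eff_resistance_eq_rho R_def right_diff_distrib diff_divide_distrib)
  also have "\<dots> = R * L e / (L e + R)"
    using R0 L0 by (simp add: field_simps)
  finally have rho: "rho e = R * L e / (L e + R)" .
  have LR: "L e + R \<noteq> 0" using R0 L0 by simp
  show ?A unfolding R rho using L0 by simp
  have "L e - R * L e / (L e + R) = (L e * (L e + R) - R * L e) / (L e + R)"
    using LR by (simp add: diff_divide_distrib)
  then show ?B
    unfolding R rho by (simp add: power2_eq_square algebra_simps)
qed

end

section \<open>Contracting an edge\<close>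

lemma verts_contract: "verts (contract G e) = (\<lambda>x. if x = head G e then tail G e else x) ` verts G"
  and arcs_contract: "arcs (contract G e) = arcs G - {e}"
  and tail_contract: "tail (contract G e) f = (if tail G f = head G e then tail G e else tail G f)"
  and head_contract: "head (contract G e) f = (if head G f = head G e then tail G e else head G f)"
  by (auto simp: contract_def Let_def)

lemma grad_contract:
  "f (tail G e) = f (head G e) \<Longrightarrow> grad (contract G e) f = grad G f"
  by (auto simp: grad_def tail_contract head_contract fun_eq_iff)

lemma contract_del_arc:
  "pre_digraph.del_arc (contract G e) f = contract (pre_digraph.del_arc G f) e"
  by (auto simp: contract_def pre_digraph.del_arc_def Let_def)

context network
begin

text \<open>For connectedness, a function on the contracted graph is pulled back along the vertex
  identification; the pullback has no drop along \<open>e\<close>.\<close>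

lemma network_contract:
  assumes e: "e \<in> arcs G"
  shows "network (contract G e) L"
proof
  show "finite (verts (contract G e))" "finite (arcs (contract G e))"
    by (auto simp: verts_contract arcs_contract)
  show "verts (contract G e) \<noteq> {}"
    using verts_nonempty by (auto simp: verts_contract)
  fix f assume "f \<in> arcs (contract G e)"
  then have f: "f \<in> arcs G" by (simp add: arcs_contract)
  then show "tail (contract G e) f \<in> verts (contract G e)"
    "head (contract G e) f \<in> verts (contract G e)"
    using f e head_in_verts[OF e] unfolding verts_contract tail_contract head_contract by auto
  show "L f > 0" using f by (rule length_pos)
next
  fix f :: "'a \<Rightarrow> real" and x y
  assume f0: "\<And>e'. e' \<in> arcs (contract G e) \<Longrightarrow> grad (contract G e) f e' = 0"
    and x: "x \<in> verts (contract G e)" and y: "y \<in> verts (contract G e)"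
  let ?q = "\<lambda>x. if x = head G e then tail G e else x"
  have "f (?q x') = f (?q y')" if "x' \<in> verts G" "y' \<in> verts G" for x' y'
  proof (rule grad_zero_imp_eq[OF _ that, of "\<lambda>x. f (?q x)"])
    fix e' assume "e' \<in> arcs G"
    then show "grad G (\<lambda>x. f (?q x)) e' = 0"
      using f0[of e'] by (cases "e' = e") (auto simp: grad_def arcs_contract tail_contract head_contract)
  qed
  then show "f x = f y"
    using x y unfolding verts_contract by (blast elim!: imageE)
qed

lemma card_verts_contract:
  assumes e: "e \<in> arcs G" and "tail G e \<noteq> head G e"
  shows "card (verts (contract G e)) = card (verts G) - 1"
proof -
  have "verts (contract G e) = verts G - {head G e}"
    using assms by (auto simp: verts_contract)
  then show ?thesis using e by simp
qed

end

context grounded_network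
begin

text \<open>A rank-one correction: the functions with equal values at the ends of \<open>e\<close>
  are those energy-orthogonal to \<open>dipole e\<close>, and removing the component along
  \<open>dipole e\<close> from \<open>g\<close> gives the kernel of that subspace.\<close>

definition contract_Green :: "'b \<Rightarrow> 'a \<Rightarrow> 'a \<Rightarrow> real" where
  "contract_Green e z x = g z x - dipole e z * dipole e x / rho e"

context
  fixes e
  assumes e: "e \<in> arcs G" and nonloop: "tail G e \<noteq> head G e"
begin

lemma rho_nonzero: "rho e \<noteq> 0"
  using rho_pos[OF e nonloop] by simp

text \<open>The correction cancels the drop along \<open>e\<close> in each argument, so the kernel
  descends to the contracted graph.\<close>

lemma contract_Green_tail_head:
  assumes "z \<in> verts G"
  shows "contract_Green e z (tail G e) = contract_Green e z (head G e)"
    and "contract_Green e (tail G e) z = contract_Green e (head G e) z"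
proof -
  have "contract_Green e z (tail G e) - contract_Green e z (head G e)
      = dipole e z - dipole e z * rho e / rho e"
    using dipole_eq_grad_Green[OF e assms]
    by (simp add: contract_Green_def rho_def grad_def algebra_simps diff_divide_distrib)
  then show "contract_Green e z (tail G e) = contract_Green e z (head G e)"
    using rho_nonzero by simp
  have "contract_Green e (tail G e) z - contract_Green e (head G e) z
      = dipole e z - (dipole e (tail G e) - dipole e (head G e)) * dipole e z / rho e"
    unfolding contract_Green_def left_diff_distrib diff_divide_distrib by (simp add: dipole_def[of e z])
  also have "dipole e (tail G e) - dipole e (head G e) = rho e"
    by (simp add: rho_def grad_def)
  finally show "contract_Green e (tail G e) z = contract_Green e (head G e) z"
    using rho_nonzero by simp
qed

lemma contract_Green_diag_tail_head:
  "contract_Green e (tail G e) (tail G e) = contract_Green e (head G e) (head G e)"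
  using contract_Green_tail_head[of "tail G e"] contract_Green_tail_head[of "head G e"] e by simp

text \<open>If the base point is the head of \<open>e\<close>, it is renamed to the tail, which
  represents the merged vertex.\<close>

lemma grounded_network_contract:
  "grounded_network (contract G e) L (if b = head G e then tail G e else b) (contract_Green e)"
    (is "grounded_network _ _ ?b _")
proof -
  interpret C: network "contract G e" L by (rule network_contract[OF e])
  show ?thesis
  proof
    show "?b \<in> verts (contract G e)"
      using base_in_verts by (simp add: verts_contract)
  next
    fix z assume "z \<in> verts (contract G e)"
    then have zV: "z \<in> verts G"
      using e by (auto simp: verts_contract)
    have "contract_Green e z b = 0"
      using Green_base[OF zV] dipole_base[OF e] by (simp add: contract_Green_def)
    then show "contract_Green e z ?b = 0"
      using contract_Green_tail_head(1)[OF zV] by (cases "b = head G e") simp_all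
  next
    fix z w
    assume z: "z \<in> verts (contract G e)"
    then have zV: "z \<in> verts G" and zq: "z \<noteq> head G e"
      using e nonloop by (auto simp: verts_contract)
    let ?q = "\<lambda>x. if x = head G e then tail G e else x"
    have "energy (contract G e) L w (contract_Green e z) = energy G L (\<lambda>x. w (?q x)) (contract_Green e z)"
      unfolding energy_def arcs_contract sum.remove[OF finite_arcs e]
        grad_contract[OF contract_Green_tail_head(1)[OF zV]]
      by (auto simp: grad_def tail_contract head_contract intro!: sum.cong)
    \<comment> \<open>The dipole term pairs with the drop of the pulled-back \<open>w\<close> along
      \<open>e\<close>, which is zero because both ends are identified.\<close>
    also have "\<dots> = (w (?q z) - w ?b) - (dipole e z / rho e) * (w (?q (tail G e)) - w (?q (head G e)))"
    proof -
      have *: "contract_Green e z = (\<lambda>x. g z x - (dipole e z / rho e) * dipole e x)"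
        by (simp add: contract_Green_def fun_eq_iff)
      show ?thesis
        unfolding * energy_linear energy_Green[OF zV] energy_dipole[OF e] by (simp add: grad_def)
    qed
    also have "\<dots> = w z - w ?b"
      using zq by simp
    finally show "energy (contract G e) L w (contract_Green e z) = w z - w ?b" .
  qed
qed

end

section \<open>The invariants as edge sums and their change under contraction\<close>

definition normalized_z :: real where
  "normalized_z = (\<Sum>f\<in>arcs G. L f - rho f)"

text \<open>
  This is \<open>12 * tau\<close>: the resistance from the base point is \<open>g x x\<close> at a vertex \<open>x\<close>, and it is
  a quadratic polynomial with leading coefficient \<open>- (L f - rho f) / (L f)\<^sup>2\<close> along \<open>f\<close>.
\<close>

definition normalized_tau :: real where
  "normalized_tau = (\<Sum>f\<in>arcs G. (3 * (grad G (\<lambda>x. g x x) f)\<^sup>2 + (L f - rho f)\<^sup>2) / L f)"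

context
  fixes e
  assumes e: "e \<in> arcs G" and nonloop: "tail G e \<noteq> head G e"
begin

text \<open>The kernel does not distinguish the merged ends, so the resistance is its second
  difference at the original ends of \<open>f\<close>, where the rank-one correction becomes a
  square.\<close>

lemma rho_contract:
  assumes f: "f \<in> arcs G"
  shows "grounded_network.rho (contract G e) (contract_Green e) f
    = rho f - (grad G (dipole e) f)\<^sup>2 / rho e"
proof -
  interpret C: grounded_network "contract G e" L "if b = head G e then tail G e else b"
    "contract_Green e"
    by (rule grounded_network_contract[OF e nonloop])
  let ?q = "\<lambda>x. if x = head G e then tail G e else x"
  have q: "contract_Green e (?q x) (?q y) = contract_Green e x y" if "x \<in> verts G" "y \<in> verts G" for x y
    using contract_Green_tail_head[OF e nonloop, OF that(1)]
      contract_Green_tail_head[OF e nonloop, OF that(2)]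
      contract_Green_diag_tail_head[OF e nonloop] by auto
  let ?a = "tail G f" and ?h = "head G f"
  have "C.rho f = (contract_Green e (?q ?a) (?q ?a) - contract_Green e (?q ?h) (?q ?a))
    - (contract_Green e (?q ?a) (?q ?h) - contract_Green e (?q ?h) (?q ?h))"
    unfolding C.rho_def C.dipole_def grad_def tail_contract head_contract ..
  also have "\<dots> = (contract_Green e ?a ?a - contract_Green e ?h ?a)
    - (contract_Green e ?a ?h - contract_Green e ?h ?h)"
    using f by (simp only: q tail_in_verts head_in_verts)
  also have "\<dots> = rho f - (grad G (dipole e) f * grad G (dipole e) f) / rho e"
    unfolding grad_def rho_def contract_Green_def dipole_def[of f]
    by (simp add: diff_divide_distrib add_divide_distrib algebra_simps)
  finally show ?thesis by (simp add: power2_eq_square)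
qed

lemma grad_contract_Green_diag:
  "grad (contract G e) (\<lambda>x. contract_Green e x x) f
    = grad G (\<lambda>x. g x x) f - grad G (\<lambda>x. (dipole e x)\<^sup>2) f / rho e"
  by (subst grad_contract[OF contract_Green_diag_tail_head[OF e nonloop]])
    (simp add: contract_Green_def power2_eq_square)

text \<open>Equality of the corrected diagonal at both ends of \<open>e\<close>, solved for the drop
  of the squared dipole.\<close>

lemma grad_dipole_square_self: "grad G (\<lambda>x. (dipole e x)\<^sup>2) e = rho e * grad G (\<lambda>x. g x x) e"
  using contract_Green_diag_tail_head[OF e nonloop] rho_nonzero[OF e nonloop]
  by (simp add: contract_Green_def grad_def field_simps power2_eq_square)

text \<open>The sum is extended to all arcs: the formula for the contracted resistance gives 0 at
  \<open>f = e\<close>, so the extra summand is \<open>L e\<close>.\<close>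

lemma normalized_z_contract:
  "grounded_network.normalized_z (contract G e) L (contract_Green e)
    = normalized_z + (\<Sum>f\<in>arcs G. (grad G (dipole e) f)\<^sup>2 / rho e) - L e"
proof -
  interpret C: grounded_network "contract G e" L "if b = head G e then tail G e else b"
    "contract_Green e"
    by (rule grounded_network_contract[OF e nonloop])
  have "C.normalized_z = (\<Sum>f\<in>arcs G - {e}. L f - rho f + (grad G (dipole e) f)\<^sup>2 / rho e)"
    unfolding C.normalized_z_def arcs_contract by (intro sum.cong) (simp_all add: rho_contract)
  also have "\<dots> = (\<Sum>f\<in>arcs G. L f - rho f + (grad G (dipole e) f)\<^sup>2 / rho e)
      - (L e - rho e + (grad G (dipole e) e)\<^sup>2 / rho e)"
    by (subst sum_diff1) (use e in simp_all)
  also have "L e - rho e + (grad G (dipole e) e)\<^sup>2 / rho e = L e"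
    using rho_nonzero[OF e nonloop] by (simp add: rho_def[symmetric] power2_eq_square)
  finally show ?thesis
    by (simp add: normalized_z_def sum.distrib)
qed

lemma normalized_tau_contract:
  "grounded_network.normalized_tau (contract G e) L (contract_Green e)
    = (\<Sum>f\<in>arcs G. (3 * (grad G (\<lambda>x. g x x) f - grad G (\<lambda>x. (dipole e x)\<^sup>2) f / rho e)\<^sup>2
        + (L f - rho f + (grad G (dipole e) f)\<^sup>2 / rho e)\<^sup>2) / L f) - L e"
    (is "_ = (\<Sum>f\<in>arcs G. ?F f) - L e")
proof -
  interpret C: grounded_network "contract G e" L "if b = head G e then tail G e else b"
    "contract_Green e"
    by (rule grounded_network_contract[OF e nonloop])
  have "C.normalized_tau = (\<Sum>f\<in>arcs G - {e}. ?F f)"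
    unfolding C.normalized_tau_def arcs_contract grad_contract_Green_diag
    by (intro sum.cong) (simp_all add: rho_contract diff_diff_eq2 diff_add_eq)
  also have "\<dots> = (\<Sum>f\<in>arcs G. ?F f) - ?F e"
    by (subst sum_diff1) (use e in simp_all)
  \<comment> \<open>At \<open>e\<close> the corrected gradient and the contracted resistance both
    vanish, which leaves only the square of \<open>L e\<close> over \<open>L e\<close>.\<close>
  also have "?F e = L e"
  proof -
    have "(grad G (dipole e) e)\<^sup>2 / rho e = rho e"
      using rho_nonzero[OF e nonloop] by (simp add: rho_def[symmetric] power2_eq_square)
    then show ?thesis
      using rho_nonzero[OF e nonloop]
      by (simp add: grad_dipole_square_self) (simp add: power2_eq_square)
  qed
  finally show ?thesis .
qed

text \<open>
  The left-hand side is \<open>4 * energy (dipole e ^ 3) (dipole e)\<close>, by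
  \<open>3 (x\<^sup>2 - y\<^sup>2)\<^sup>2 + (x - y)\<^sup>4 = 4 (x - y) (x\<^sup>3 - y\<^sup>3)\<close>.
\<close>

lemma sum_quartic:
  "(\<Sum>f\<in>arcs G. (3 * (grad G (\<lambda>x. (dipole e x)\<^sup>2) f)\<^sup>2 + (grad G (dipole e) f) ^ 4) / L f)
    = rho e * (3 * (grad G (\<lambda>x. g x x) e)\<^sup>2 + (rho e)\<^sup>2)"
proof -
  have quartic: "3 * (x\<^sup>2 - y\<^sup>2)\<^sup>2 + (x - y) ^ 4 = 4 * ((x ^ 3 - y ^ 3) * (x - y))" for x y :: real
    by (simp add: power2_eq_square power3_eq_cube power4_eq_xxxx algebra_simps)
  have "(\<Sum>f\<in>arcs G. (3 * (grad G (\<lambda>x. (dipole e x)\<^sup>2) f)\<^sup>2 + (grad G (dipole e) f) ^ 4) / L f)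
    = 4 * energy G L (\<lambda>x. dipole e x ^ 3) (dipole e)"
    unfolding energy_def sum_distrib_left grad_def quartic by simp
  also have "\<dots> = 4 * grad G (\<lambda>x. dipole e x ^ 3) e"
    by (simp add: energy_dipole[OF e])
  finally have eq: "(\<Sum>f\<in>arcs G. (3 * (grad G (\<lambda>x. (dipole e x)\<^sup>2) f)\<^sup>2 + (grad G (dipole e) f) ^ 4) / L f)
    = 4 * grad G (\<lambda>x. dipole e x ^ 3) e" .
  let ?x = "dipole e (tail G e)" and ?y = "dipole e (head G e)"
  have rho: "rho e = ?x - ?y" by (simp add: rho_def grad_def)
  have "grad G (\<lambda>x. (dipole e x)\<^sup>2) e = rho e * (?x + ?y)"
    unfolding rho grad_def by (simp add: power2_eq_square algebra_simps)
  then have "grad G (\<lambda>x. g x x) e = ?x + ?y"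
    using grad_dipole_square_self rho_nonzero[OF e nonloop] by simp
  then show ?thesis
    unfolding eq rho grad_def[of G "\<lambda>x. dipole e x ^ 3"]
    by (simp only:) (simp add: power2_eq_square power3_eq_cube algebra_simps)
qed

end

section \<open>Weighted sums over the contracted edge\<close>

lemma loop_cases:
  assumes "e \<in> arcs G"
  obtains (nonloop) "tail G e \<noteq> head G e"
  | (loop) "rho e = 0" "dipole e = (\<lambda>x. 0)" "grad G (\<lambda>x. g x x) e = 0"
  by (cases "tail G e = head G e") (auto simp: rho_loop dipole_def[abs_def] grad_def)

text \<open>Foster's theorem gives the factor. The dipole terms add up to the total of
  \<open>rho\<close> by Parseval and cancel against the subtracted \<open>L e\<close>; loops have
  weight 0.\<close>

lemma sum_normalized_z_contract:
  "(\<Sum>e\<in>arcs G. rho e / L e * grounded_network.normalized_z (contract G e) L (contract_Green e))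
    = (real (card (verts G)) - 1) * normalized_z" (is "(\<Sum>e\<in>_. rho e / L e * ?Z e) = _")
proof -
  have "rho e / L e * ?Z e
    = rho e / L e * normalized_z + (\<Sum>f\<in>arcs G. (grad G (dipole e) f)\<^sup>2 / L e) - rho e"
    if e: "e \<in> arcs G" for e
    using e
  proof (cases rule: loop_cases)
    case nonloop
    show ?thesis
      unfolding normalized_z_contract[OF e nonloop]
      using rho_nonzero[OF e nonloop] length_pos[OF e]
      by (simp add: algebra_simps sum_divide_distrib[symmetric])
  next
    case loop
    then show ?thesis by simp
  qed
  then have "(\<Sum>e\<in>arcs G. rho e / L e * ?Z e)
    = (\<Sum>e\<in>arcs G. rho e / L e) * normalized_z
      + (\<Sum>e\<in>arcs G. \<Sum>f\<in>arcs G. (grad G (dipole e) f)\<^sup>2 / L e) - (\<Sum>e\<in>arcs G. rho e)"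
    by (simp add: sum.distrib sum_subtractf sum_distrib_right)
  also have "(\<Sum>e\<in>arcs G. \<Sum>f\<in>arcs G. (grad G (dipole e) f)\<^sup>2 / L e) = (\<Sum>f\<in>arcs G. rho f)"
    by (subst sum.swap) (simp add: sum_grad_dipole_squares)
  finally show ?thesis
    by (simp add: Foster)
qed

lemma sum_normalized_tau_contract:
  "(\<Sum>e\<in>arcs G. rho e / L e * grounded_network.normalized_tau (contract G e) L (contract_Green e))
    = (real (card (verts G)) - 2) * normalized_tau + normalized_z"
    (is "(\<Sum>e\<in>_. rho e / L e * ?T e) = _")
proof -
  define k where "k = grad G (\<lambda>x. g x x)"
  define S where "S = (\<lambda>e f. grad G (\<lambda>x. (dipole e x)\<^sup>2) f)"
  define D where "D = (\<lambda>e f. grad G (dipole e) f)"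
  \<comment> \<open>\<open>A e f\<close> collects the mixed terms of the expanded squares, so that
    they can be summed over \<open>e\<close> first.\<close>
  define A where "A = (\<lambda>e f. (2 * (L f - rho f) * ((D e f)\<^sup>2 / L e) - 6 * k f * (S e f / L e)) / L f)"
  have tau_k: "normalized_tau = (\<Sum>f\<in>arcs G. (3 * (k f)\<^sup>2 + (L f - rho f)\<^sup>2) / L f)"
    by (simp add: normalized_tau_def k_def)
  have T: "rho e / L e * ?T e = rho e / L e * normalized_tau + (\<Sum>f\<in>arcs G. A e f)
      + (3 * (k e)\<^sup>2 + (rho e)\<^sup>2) / L e - rho e" if e: "e \<in> arcs G" for e
    using e
  proof (cases rule: loop_cases)
    case nonloop
    have r: "rho e \<noteq> 0" and L0: "L e \<noteq> 0"
      using rho_nonzero[OF e nonloop] length_pos[OF e] by auto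
    have expand: "rho e / L e * ((3 * (k f - S e f / rho e)\<^sup>2 + (L f - rho f + (D e f)\<^sup>2 / rho e)\<^sup>2) / L f)
      = rho e / L e * ((3 * (k f)\<^sup>2 + (L f - rho f)\<^sup>2) / L f) + A e f
        + (3 * (S e f)\<^sup>2 + (D e f) ^ 4) / L f / (rho e * L e)" if f: "f \<in> arcs G" for f
    proof -
      have Lf: "L f \<noteq> 0" using length_pos[OF f] by auto
      show ?thesis
        unfolding A_def using r L0 Lf
        by (simp add: power2_eq_square power4_eq_xxxx divide_simps) (simp add: algebra_simps)
    qed
    have "rho e / L e * ?T e
      = (\<Sum>f\<in>arcs G. rho e / L e * ((3 * (k f - S e f / rho e)\<^sup>2 + (L f - rho f + (D e f)\<^sup>2 / rho e)\<^sup>2) / L f))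
        - rho e"
      unfolding normalized_tau_contract[OF e nonloop] right_diff_distrib sum_distrib_left k_def S_def D_def
      using L0 by simp
    also have "\<dots> = rho e / L e * normalized_tau + (\<Sum>f\<in>arcs G. A e f)
        + (\<Sum>f\<in>arcs G. (3 * (S e f)\<^sup>2 + (D e f) ^ 4) / L f) / (rho e * L e) - rho e"
      by (simp add: expand sum.distrib tau_k sum_distrib_left sum_divide_distrib
          del: times_divide_eq_left times_divide_eq_right divide_divide_eq_left divide_divide_eq_right)
    also have "(\<Sum>f\<in>arcs G. (3 * (S e f)\<^sup>2 + (D e f) ^ 4) / L f) = rho e * (3 * (k e)\<^sup>2 + (rho e)\<^sup>2)"
      unfolding S_def D_def k_def by (rule sum_quartic[OF e nonloop])
    finally show ?thesis using r by simp
  next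
    case loop
    then show ?thesis by (simp add: A_def S_def D_def k_def)
  qed
  have A: "(\<Sum>e\<in>arcs G. A e f) = (2 * (L f - rho f) * rho f - 6 * (k f)\<^sup>2) / L f"
    if f: "f \<in> arcs G" for f
  proof -
    have "(\<Sum>e\<in>arcs G. A e f) = (2 * (L f - rho f) * (\<Sum>e\<in>arcs G. (D e f)\<^sup>2 / L e)
        - 6 * k f * (\<Sum>e\<in>arcs G. S e f / L e)) / L f"
      unfolding A_def sum_divide_distrib[symmetric] sum_subtractf sum_distrib_left[symmetric] ..
    then show ?thesis
      using sum_grad_dipole_squares[OF f] sum_grad_dipole_square[OF f]
      by (simp add: D_def S_def k_def power2_eq_square)
  qed
  have "(\<Sum>e\<in>arcs G. rho e / L e * ?T e)
    = (\<Sum>e\<in>arcs G. rho e / L e) * normalized_tau + (\<Sum>e\<in>arcs G. \<Sum>f\<in>arcs G. A e f)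
      + (\<Sum>e\<in>arcs G. (3 * (k e)\<^sup>2 + (rho e)\<^sup>2) / L e) - (\<Sum>e\<in>arcs G. rho e)"
    by (simp add: T sum.distrib sum_subtractf sum_distrib_right
        del: times_divide_eq_left times_divide_eq_right)
  also have "(\<Sum>e\<in>arcs G. \<Sum>f\<in>arcs G. A e f)
    = (\<Sum>f\<in>arcs G. (2 * (L f - rho f) * rho f - 6 * (k f)\<^sup>2) / L f)"
    by (subst sum.swap) (simp add: A)
  \<comment> \<open>The mixed terms contain \<open>normalized_tau\<close> with a minus sign, which
    lowers Foster's factor from \<open>v - 1\<close> to \<open>v - 2\<close>; apart from
    \<open>normalized_z\<close> the rest cancels.\<close>
  also have "\<dots> = (\<Sum>f\<in>arcs G. (L f - rho f) + rho f - (3 * (k f)\<^sup>2 + (L f - rho f)\<^sup>2) / L f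
      - (3 * (k f)\<^sup>2 + (rho f)\<^sup>2) / L f)"
    using length_pos
    by (intro sum.cong refl) (force simp: field_simps power2_eq_square)
  also have "\<dots> = normalized_z + (\<Sum>e\<in>arcs G. rho e) - normalized_tau
      - (\<Sum>e\<in>arcs G. (3 * (k e)\<^sup>2 + (rho e)\<^sup>2) / L e)"
    unfolding normalized_z_def tau_k sum_subtractf sum.distrib by simp
  finally show ?thesis
    by (simp add: Foster algebra_simps)
qed

end

section \<open>Points inside the edges\<close>

definition consecutive :: "real set \<Rightarrow> (real \<times> real) set" where
  "consecutive C = {(s, t). s \<in> C \<and> t \<in> C \<and> s < t \<and> (\<forall>u\<in>C. \<not> (s < u \<and> u < t))}"

lemma finite_consecutive: "finite C \<Longrightarrow> finite (consecutive C)"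
  by (rule finite_subset[of _ "C \<times> C"]) (auto simp: consecutive_def)

text \<open>Telescoping; the induction peels off the first segment, from \<open>a\<close> to the
  next point \<open>c\<close> of \<open>C\<close>.\<close>

lemma sum_consecutive:
  fixes F :: "real \<Rightarrow> real"
  assumes C: "finite C" and "a \<in> C" and b: "b \<in> C" and "a \<le> b"
  shows "(\<Sum>(s, t) | (s, t) \<in> consecutive C \<and> a \<le> s \<and> t \<le> b. F t - F s) = F b - F a"
  using assms(2,4)
proof (induction "card {c \<in> C. a < c \<and> c \<le> b}" arbitrary: a rule: less_induct)
  case less
  show ?case
  proof (cases "a = b")
    case True
    then have "{(s, t). (s, t) \<in> consecutive C \<and> a \<le> s \<and> t \<le> b} = {}"
      by (auto simp: consecutive_def)
    then have "(\<Sum>(s, t) | (s, t) \<in> consecutive C \<and> a \<le> s \<and> t \<le> b. F t - F s) = 0"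
      by (metis sum.empty)
    then show ?thesis using True by simp
  next
    case False
    let ?A = "{c \<in> C. a < c \<and> c \<le> b}"
    define c where "c = Min ?A"
    have fin: "finite ?A" using C by simp
    have "b \<in> ?A" using b less.prems False by simp
    then have ne: "?A \<noteq> {}" by blast
    have c: "c \<in> C" "a < c" "c \<le> b" using Min_in[OF fin ne] by (auto simp: c_def)
    have c_min: "c \<le> u" if "u \<in> C" "a < u" for u
      using that Min_le[OF fin, of u] c by (cases "u \<le> b") (auto simp: c_def)
    have "{u \<in> C. c < u \<and> u \<le> b} \<subset> ?A" using c by auto
    then have IH: "(\<Sum>(s, t) | (s, t) \<in> consecutive C \<and> c \<le> s \<and> t \<le> b. F t - F s) = F b - F c"
      using less.hyps[OF psubset_card_mono[OF fin]] c by auto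
    have split: "{(s, t). (s, t) \<in> consecutive C \<and> a \<le> s \<and> t \<le> b}
      = insert (a, c) {(s, t). (s, t) \<in> consecutive C \<and> c \<le> s \<and> t \<le> b}"
    proof (intro set_eqI, clarify)
      fix s t
      have "s = a \<and> t = c" if *: "(s, t) \<in> consecutive C" "a \<le> s" "s < c"
      proof -
        have "s = a" using * c_min[of s] by (force simp: consecutive_def)
        moreover have "t = c" using * c c_min[of t] calculation by (force simp: consecutive_def)
        ultimately show ?thesis by simp
      qed
      moreover have "(a, c) \<in> consecutive C"
        using c less.prems c_min by (force simp: consecutive_def)
      ultimately show "(s, t) \<in> {(s, t). (s, t) \<in> consecutive C \<and> a \<le> s \<and> t \<le> b} \<longleftrightarrow>
          (s, t) \<in> insert (a, c) {(s, t). (s, t) \<in> consecutive C \<and> c \<le> s \<and> t \<le> b}"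
        using c by (cases "s < c") auto
    qed
    have "finite {(s, t). (s, t) \<in> consecutive C \<and> c \<le> s \<and> t \<le> b}"
      by (rule finite_subset[OF _ finite_consecutive[OF C]]) auto
    then have "(\<Sum>(s, t) | (s, t) \<in> consecutive C \<and> a \<le> s \<and> t \<le> b. F t - F s)
      = F c - F a + (\<Sum>(s, t) | (s, t) \<in> consecutive C \<and> c \<le> s \<and> t \<le> b. F t - F s)"
      unfolding split using c by (subst sum.insert) auto
    then show ?thesis unfolding IH by simp
  qed
qed

section \<open>The Green function at arbitrary points of the metrized graph\<close>

definition interpolate ::
    "('a, 'b) pre_digraph \<Rightarrow> ('b \<Rightarrow> real) \<Rightarrow> ('a \<Rightarrow> real) \<Rightarrow> ('a, 'b) point \<Rightarrow> real" where
  "interpolate G L w x =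
    (case x of Vertex v \<Rightarrow> w v | Inner e t \<Rightarrow> w (tail G e) - grad G w e * t / L e)"

text \<open>
  The Green function of the segment \<open>e\<close> with both ends grounded, with the source at \<open>y\<close>.
\<close>

definition bump :: "('b \<Rightarrow> real) \<Rightarrow> ('a, 'b) point \<Rightarrow> 'b \<Rightarrow> real \<Rightarrow> real" where
  "bump L y e u =
    (case y of Vertex v \<Rightarrow> 0 | Inner f t \<Rightarrow> if f = e then min t u - t * u / L e else 0)"

lemma arcs_subdivide:
  "arcs (subdivide G L S) = Sigma (arcs G) (\<lambda>e. consecutive (cut_positions L S e))"
  by (auto simp: subdivide_def consecutive_def)

lemma verts_subdivide: "verts (subdivide G L S) = Vertex ` verts G \<union> S"
  by (simp add: subdivide_def)

lemma grad_subdivide: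
  "grad (subdivide G L S) f (e, s, t) = f (edge_point G L e s) - f (edge_point G L e t)"
  by (simp add: grad_def subdivide_def)

lemma edge_point_0 [simp]: "edge_point G L e 0 = Vertex (tail G e)"
  by (simp add: edge_point_def)

lemma zero_in_cut_positions [simp]: "0 \<in> cut_positions L S e"
  and length_in_cut_positions [simp]: "L e \<in> cut_positions L S e"
  by (auto simp: cut_positions_def)

context network
begin

lemma edge_point_length: "e \<in> arcs G \<Longrightarrow> edge_point G L e (L e) = Vertex (head G e)"
  using length_pos[of e] by (simp add: edge_point_def)

lemma finite_cut_positions:
  assumes "finite S"
  shows "finite (cut_positions L S e)"
proof -
  have "finite (Inner e -` S)"
    using assms by (rule finite_vimageI) (auto simp: inj_def)
  then show ?thesis by (simp add: cut_positions_def vimage_def)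
qed

lemma cut_positions_bounds:
  assumes "S \<subseteq> points G L" "e \<in> arcs G" "u \<in> cut_positions L S e"
  shows "0 \<le> u" "u \<le> L e"
  using assms length_pos[OF assms(2)] by (auto simp: cut_positions_def points_def)

lemma edge_point_in_verts_subdivide:
  assumes "S \<subseteq> points G L" "e \<in> arcs G" "u \<in> cut_positions L S e"
  shows "edge_point G L e u \<in> verts (subdivide G L S)"
  using assms cut_positions_bounds[OF assms]
  by (auto simp: edge_point_def verts_subdivide cut_positions_def)

text \<open>For connectedness, a function without drop on any segment is constant along each edge by
  telescoping, so its restriction to the original vertices has zero gradient in
  \<open>G\<close>.\<close>

lemma network_subdivide:
  assumes S: "finite S" "S \<subseteq> points G L"
  shows "network (subdivide G L S) (\<lambda>(e, s, t). t - s)"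
proof
  show "finite (verts (subdivide G L S))" using S by (simp add: verts_subdivide)
  show "finite (arcs (subdivide G L S))"
    unfolding arcs_subdivide using S by (auto intro!: finite_SigmaI finite_consecutive finite_cut_positions)
  show "verts (subdivide G L S) \<noteq> {}" using verts_nonempty by (simp add: verts_subdivide)
next
  fix a assume a: "a \<in> arcs (subdivide G L S)"
  then obtain e s t where est: "a = (e, s, t)" "e \<in> arcs G" "s \<in> cut_positions L S e"
    "t \<in> cut_positions L S e" "s < t"
    by (auto simp: arcs_subdivide consecutive_def)
  have "tail (subdivide G L S) a = edge_point G L e s" "head (subdivide G L S) a = edge_point G L e t"
    by (simp_all add: est subdivide_def)
  then show "tail (subdivide G L S) a \<in> verts (subdivide G L S)"
    "head (subdivide G L S) a \<in> verts (subdivide G L S)"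
    using est edge_point_in_verts_subdivide[OF S(2)] by auto
  show "0 < (case a of (e, s, t) \<Rightarrow> t - s)" using est by simp
next
  fix f x y
  assume f: "\<And>a. a \<in> arcs (subdivide G L S) \<Longrightarrow> grad (subdivide G L S) f a = 0"
    and x: "x \<in> verts (subdivide G L S)" and y: "y \<in> verts (subdivide G L S)"
  have edge: "f (edge_point G L e u) = f (Vertex (tail G e))"
    if e: "e \<in> arcs G" and u: "u \<in> cut_positions L S e" for e u
  proof -
    let ?C = "cut_positions L S e"
    have "f (edge_point G L e u) - f (edge_point G L e 0)
      = (\<Sum>(s, t) | (s, t) \<in> consecutive ?C \<and> 0 \<le> s \<and> t \<le> u.
          f (edge_point G L e t) - f (edge_point G L e s))"
      using u cut_positions_bounds[OF S(2) e u]
      by (subst sum_consecutive[OF finite_cut_positions[OF S(1)], of 0 e u]) auto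
    also have "\<dots> = 0"
    proof (intro sum.neutral ballI, clarify)
      fix s t assume "(s, t) \<in> consecutive ?C"
      then show "f (edge_point G L e t) - f (edge_point G L e s) = 0"
        using f[of "(e, s, t)"] e by (simp add: arcs_subdivide grad_subdivide)
    qed
    finally show ?thesis by simp
  qed
  have vert: "f (Vertex v) = f (Vertex v')" if "v \<in> verts G" "v' \<in> verts G" for v v'
  proof (rule grad_zero_imp_eq[OF _ that, of "\<lambda>v. f (Vertex v)"])
    fix e assume e: "e \<in> arcs G"
    show "grad G (\<lambda>v. f (Vertex v)) e = 0"
      using edge[OF e length_in_cut_positions] e by (simp add: edge_point_length grad_def)
  qed
  have "\<exists>v\<in>verts G. f z = f (Vertex v)" if z: "z \<in> verts (subdivide G L S)" for z
  proof (cases z)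
    case (Vertex v)
    then show ?thesis using z S by (auto simp: verts_subdivide points_def)
  next
    case (Inner e t)
    then have t: "e \<in> arcs G" "0 < t" "t < L e" "Inner e t \<in> S"
      using z S by (auto simp: verts_subdivide points_def)
    then have "f (edge_point G L e t) = f (Vertex (tail G e))"
      by (intro edge) (auto simp: cut_positions_def)
    then show ?thesis using t Inner by (auto simp: edge_point_def)
  qed
  then show "f x = f y" using x y vert by metis
qed

end

context grounded_network
begin

text \<open>The potential at the original vertices for a source at \<open>y\<close>: a source inside
  an edge acts on them like sources at both ends, weighted linearly by its position.\<close>

definition source_Green :: "('a, 'b) point \<Rightarrow> 'a \<Rightarrow> real" where
  "source_Green y u = interpolate G L (\<lambda>z. g z u) y"

text \<open>The potential is linear along every edge except the one carrying the source in its
  interior, where the tent-shaped \<open>bump\<close> supplies the kink.\<close>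

definition point_Green :: "('a, 'b) point \<Rightarrow> ('a, 'b) point \<Rightarrow> real" where
  "point_Green y x = interpolate G L (source_Green y) x
    + (case x of Vertex v \<Rightarrow> 0 | Inner e u \<Rightarrow> bump L y e u)"

lemma points_cases:
  assumes "y \<in> points G L"
  obtains (vertex) v where "y = Vertex v" "v \<in> verts G"
  | (inner) e p where "y = Inner e p" "e \<in> arcs G" "0 < p" "p < L e"
  using assms by (auto simp: points_def)

lemma energy_source_Green:
  assumes "y \<in> points G L"
  shows "energy G L w (source_Green y) = interpolate G L w y - w b"
  using assms
proof (cases rule: points_cases)
  case (vertex v)
  then show ?thesis by (simp add: source_Green_def[abs_def] interpolate_def energy_Green)
next
  case (inner e p)
  have *: "source_Green y = (\<lambda>u. g (tail G e) u - p / L e * dipole e u)"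
    by (auto simp: fun_eq_iff source_Green_def interpolate_def inner dipole_def grad_def algebra_simps diff_divide_distrib)
  show ?thesis
    unfolding * energy_linear using inner by (simp add: energy_Green energy_dipole interpolate_def)
qed

lemma source_Green_base: "y \<in> points G L \<Longrightarrow> source_Green y b = 0"
  by (cases y rule: points_cases) (auto simp: source_Green_def interpolate_def Green_base grad_def)

text \<open>Interpolating a symmetric kernel in both arguments is symmetric, and so is the formula
  for \<open>bump\<close>.\<close>

lemma point_Green_commute:
  assumes "x \<in> points G L" "y \<in> points G L"
  shows "point_Green x y = point_Green y x"
proof -
  have "interpolate G L (source_Green x) y = interpolate G L (source_Green y) x"
    using assms(1)
  proof (cases rule: points_cases)
    case (vertex v)
    show ?thesis
      using assms(2) by (cases rule: points_cases)
        (use vertex in \<open>auto simp: interpolate_def source_Green_def grad_def Green_commute\<close>)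
  next
    case (inner e p)
    show ?thesis
      using assms(2)
    proof (cases rule: points_cases)
      case (vertex v)
      then show ?thesis
        using inner by (auto simp: interpolate_def source_Green_def grad_def Green_commute)
    next
      case (inner f t)
      have "g (tail G e) (tail G f) = g (tail G f) (tail G e)" "g (tail G e) (head G f) = g (head G f) (tail G e)"
        "g (head G e) (tail G f) = g (tail G f) (head G e)" "g (head G e) (head G f) = g (head G f) (head G e)"
        using \<open>e \<in> arcs G\<close> inner by (simp_all add: Green_commute)
      then show ?thesis
        using inner \<open>x = Inner e p\<close>
        by (simp add: interpolate_def source_Green_def grad_def algebra_simps diff_divide_distrib add_divide_distrib)
    qed
  qed
  then show ?thesis
    by (auto simp: point_Green_def bump_def min.commute mult.commute split: point.splits)
qed

lemma point_Green_edge_point: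
  assumes y: "y \<in> points G L" and e: "e \<in> arcs G" and u: "0 \<le> u" "u \<le> L e"
  shows "point_Green y (edge_point G L e u)
    = source_Green y (tail G e) - grad G (source_Green y) e * u / L e + bump L y e u"
proof -
  have "bump L y e 0 = 0" "bump L y e (L e) = 0"
    using y length_pos[OF e] by (auto simp: bump_def points_def split: point.splits)
  then show ?thesis
    using u length_pos[OF e]
    by (auto simp: edge_point_def point_Green_def interpolate_def grad_def)
qed

text \<open>The reproducing property survives subdivision: on each edge the linear part telescopes
  to the energy in \<open>G\<close>, and the kink of \<open>bump\<close> replaces the interpolated
  value at \<open>y\<close> by \<open>w y\<close>.\<close>

lemma energy_point_Green:
  assumes S: "finite S" "S \<subseteq> points G L" and y: "y \<in> S"
  shows "energy (subdivide G L S) (\<lambda>(e, s, t). t - s) w (point_Green y) = w y - w (Vertex b)"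
proof -
  define v where "v = (\<lambda>x. w (Vertex x))"
  define extra where
    "extra = (\<lambda>e. case y of Vertex _ \<Rightarrow> 0 | Inner f p \<Rightarrow> if f = e then w y - interpolate G L v y else 0)"
  have yP: "y \<in> points G L" using y S by auto
  have edge: "(\<Sum>(s, t)\<in>consecutive (cut_positions L S e).
      (w (edge_point G L e s) - w (edge_point G L e t))
        * (point_Green y (edge_point G L e s) - point_Green y (edge_point G L e t)) / (t - s))
    = grad G v e * grad G (source_Green y) e / L e + extra e"
    if e: "e \<in> arcs G" for e
  proof -
    let ?C = "cut_positions L S e"
    define W where "W = (\<lambda>u. w (edge_point G L e u))"
    define c where "c = grad G (source_Green y) e / L e"
    have C: "finite ?C" by (rule finite_cut_positions[OF S(1)])
    have bnd: "0 \<le> u" "u \<le> L e" if "u \<in> ?C" for u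
      using cut_positions_bounds[OF S(2) e that] by auto
    have W0: "W 0 = v (tail G e)" and WL: "W (L e) = v (head G e)"
      by (simp_all add: W_def v_def edge_point_length[OF e])
    have tele: "(\<Sum>(s, t) | (s, t) \<in> consecutive ?C \<and> t \<le> u. W t - W s) = W u - W 0"
      if u: "u \<in> ?C" for u
    proof -
      have "{(s, t). (s, t) \<in> consecutive ?C \<and> t \<le> u} = {(s, t). (s, t) \<in> consecutive ?C \<and> 0 \<le> s \<and> t \<le> u}"
        using bnd by (auto simp: consecutive_def)
      then show ?thesis
        using sum_consecutive[OF C zero_in_cut_positions u bnd(1)[OF u], of W] by simp
    qed
    have "{(s, t). (s, t) \<in> consecutive ?C \<and> t \<le> L e} = consecutive ?C"
      using bnd by (auto simp: consecutive_def)
    then have all: "(\<Sum>(s, t)\<in>consecutive ?C. W t - W s) = - grad G v e"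
      using tele[OF length_in_cut_positions] W0 WL by (simp add: grad_def)
    have segment: "(W s - W t) * (point_Green y (edge_point G L e s) - point_Green y (edge_point G L e t)) / (t - s)
        = (W t - W s) * (- c) + (W t - W s) * ((bump L y e t - bump L y e s) / (t - s))"
      if "(s, t) \<in> consecutive ?C" for s t
    proof -
      have st: "s < t" "s \<in> ?C" "t \<in> ?C" using that by (auto simp: consecutive_def)
      have "point_Green y (edge_point G L e s) - point_Green y (edge_point G L e t)
        = c * (t - s) - (bump L y e t - bump L y e s)"
        using point_Green_edge_point[OF yP e bnd[OF st(2)]] point_Green_edge_point[OF yP e bnd[OF st(3)]]
        by (simp add: c_def algebra_simps diff_divide_distrib)
      then have quot: "(point_Green y (edge_point G L e s) - point_Green y (edge_point G L e t)) / (t - s)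
        = c - (bump L y e t - bump L y e s) / (t - s)"
        using st(1) by (simp add: diff_divide_distrib)
      have "(x - z) * (c - d) = (z - x) * (- c) + (z - x) * d" for x z d :: real
        by (simp add: algebra_simps)
      then show ?thesis
        unfolding times_divide_eq_right[symmetric] quot .
    qed
    have bumps: "(\<Sum>(s, t)\<in>consecutive ?C. (W t - W s) * ((bump L y e t - bump L y e s) / (t - s))) = extra e"
    proof (cases "\<exists>p. y = Inner e p")
      case False
      then have "bump L y e = (\<lambda>u. 0)" "extra e = 0"
        by (auto simp: bump_def extra_def fun_eq_iff split: point.splits)
      then show ?thesis by simp
    next
      case True
      then obtain p where p: "y = Inner e p" by blast
      have pC: "p \<in> ?C" using y p by (simp add: cut_positions_def)
      have p0: "0 < p" "p < L e" using yP p by (auto simp: points_def)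
      \<comment> \<open>As \<open>p\<close> is a cut position, no segment straddles it;
        \<open>bump\<close> has slope \<open>1 - p / L e\<close> before \<open>p\<close> and
        \<open>- p / L e\<close> after it.\<close>
      have slope: "(W t - W s) * ((bump L y e t - bump L y e s) / (t - s))
        = (if t \<le> p then W t - W s else 0) + (W t - W s) * (- (p / L e))"
        if "(s, t) \<in> consecutive ?C" for s t
      proof -
        have st: "s < t" "t \<le> p \<or> p \<le> s" using that pC by (auto simp: consecutive_def)
        then have "(bump L y e t - bump L y e s) / (t - s) = (if t \<le> p then 1 else 0) - p / L e"
          using p0 by (auto simp: bump_def p field_simps)
        then show ?thesis by (simp only: right_diff_distrib) simp
      qed
      have "(\<Sum>(s, t)\<in>consecutive ?C. (W t - W s) * ((bump L y e t - bump L y e s) / (t - s)))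
        = (\<Sum>(s, t)\<in>consecutive ?C. if t \<le> p then W t - W s else 0)
          + (\<Sum>(s, t)\<in>consecutive ?C. W t - W s) * (- (p / L e))"
        unfolding sum_distrib_right sum.distrib[symmetric]
        by (intro sum.cong refl) (simp only: split_paired_all prod.case slope)
      also have "(\<Sum>(s, t)\<in>consecutive ?C. if t \<le> p then W t - W s else 0)
        = (\<Sum>(s, t) | (s, t) \<in> consecutive ?C \<and> t \<le> p. W t - W s)"
        by (rule sum.mono_neutral_cong_right) (use finite_consecutive[OF C] in \<open>auto split: if_splits\<close>)
      also have "\<dots> = W p - W 0" by (rule tele[OF pC])
      finally show ?thesis
        unfolding all W0 using p p0
        by (simp add: extra_def interpolate_def W_def edge_point_def)
    qed
    have "(\<Sum>(s, t)\<in>consecutive ?C. (W s - W t)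
        * (point_Green y (edge_point G L e s) - point_Green y (edge_point G L e t)) / (t - s))
      = (\<Sum>(s, t)\<in>consecutive ?C. W t - W s) * (- c)
        + (\<Sum>(s, t)\<in>consecutive ?C. (W t - W s) * ((bump L y e t - bump L y e s) / (t - s)))"
      unfolding sum_distrib_right sum.distrib[symmetric]
      by (intro sum.cong refl) (auto simp: segment)
    then show ?thesis
      unfolding all bumps by (simp add: W_def c_def)
  qed
  have "energy (subdivide G L S) (\<lambda>(e, s, t). t - s) w (point_Green y)
    = (\<Sum>e\<in>arcs G. grad G v e * grad G (source_Green y) e / L e + extra e)"
  proof -
    define h where "h = (\<lambda>e (s, t). (w (edge_point G L e s) - w (edge_point G L e t))
        * (point_Green y (edge_point G L e s) - point_Green y (edge_point G L e t)) / (t - s))"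
    have "energy (subdivide G L S) (\<lambda>(e, s, t). t - s) w (point_Green y)
      = (\<Sum>(e, st)\<in>Sigma (arcs G) (\<lambda>e. consecutive (cut_positions L S e)). h e st)"
      unfolding energy_def arcs_subdivide
      by (intro sum.cong refl) (auto simp: h_def grad_subdivide)
    also have "\<dots> = (\<Sum>e\<in>arcs G. \<Sum>st\<in>consecutive (cut_positions L S e). h e st)"
      by (rule sum.Sigma[symmetric])
        (use S in \<open>auto simp: finite_consecutive finite_cut_positions\<close>)
    finally show ?thesis
      unfolding h_def by (simp add: edge)
  qed
  also have "\<dots> = interpolate G L v y - v b + (\<Sum>e\<in>arcs G. extra e)"
    using energy_source_Green[OF yP, of v] by (simp add: sum.distrib energy_def)
  also have "(\<Sum>e\<in>arcs G. extra e) = w y - interpolate G L v y"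
    using yP
    by (cases rule: points_cases) (auto simp: extra_def interpolate_def v_def)
  finally show ?thesis by (simp add: v_def)
qed

text \<open>The difference of the Green functions at \<open>x\<close> and \<open>y\<close> drives a
  unit current from \<open>x\<close> to \<open>y\<close>, since the terms at \<open>b\<close>
  cancel.\<close>

lemma resistance_eq:
  assumes x: "x \<in> points G L" and y: "y \<in> points G L"
  shows "resistance G L x y = point_Green x x - 2 * point_Green y x + point_Green y y"
proof -
  have S: "finite {x, y}" "{x, y} \<subseteq> points G L" using assms by auto
  interpret N: network "subdivide G L {x, y}" "\<lambda>(e, s, t). t - s"
    by (rule network_subdivide[OF S])
  have "energy (subdivide G L {x, y}) (\<lambda>(e, s, t). t - s) w (\<lambda>z. point_Green x z - point_Green y z)
    = w x - w y" for w
    using energy_point_Green[OF S] by (simp add: energy_linear(2))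
  from N.eff_resistance_eqI[OF _ _ this] show ?thesis
    using point_Green_commute[OF assms] by (simp add: resistance_def verts_subdivide)
qed

end

section \<open>The tau invariant\<close>

text \<open>\<open>F\<close> is an antiderivative of the square. The finite set \<open>N\<close>
  absorbs the ends of an edge and the kink at the base point.\<close>

lemma has_integral_square_affine:
  fixes u v :: real
  assumes "u \<le> v" "finite N"
    and f: "\<And>s. s \<in> {u..v} - N \<Longrightarrow> f s = c + B * (l - 2 * s)"
  defines "F \<equiv> \<lambda>s. c\<^sup>2 * s + 2 * c * B * (l * s - s\<^sup>2) + B\<^sup>2 * (l\<^sup>2 * s - 2 * l * s\<^sup>2 + 4 * s ^ 3 / 3)"
  shows "((\<lambda>s. (f s)\<^sup>2) has_integral F v - F u) {u..v}"
proof (rule has_integral_spike_finite[OF \<open>finite N\<close>])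
  show "(f s)\<^sup>2 = (c + B * (l - 2 * s))\<^sup>2" if "s \<in> {u..v} - N" for s
    using f[OF that] by simp
  show "((\<lambda>s. (c + B * (l - 2 * s))\<^sup>2) has_integral F v - F u) {u..v}"
  proof (rule fundamental_theorem_of_calculus[OF \<open>u \<le> v\<close>])
    fix s
    show "(F has_vector_derivative (c + B * (l - 2 * s))\<^sup>2) (at s within {u..v})"
      unfolding F_def has_real_derivative_iff_has_vector_derivative[symmetric]
      by (auto intro!: derivative_eq_intros simp: power2_eq_square power3_eq_cube algebra_simps)
  qed
qed

context grounded_network
begin

text \<open>At relative position \<open>a = s / L e\<close>, interpolating the kernel in both
  arguments falls short of interpolating its diagonal by \<open>a * (1 - a) * rho e\<close>.\<close>

lemma source_Green_at_source:
  assumes "x \<in> points G L"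
  shows "interpolate G L (source_Green x) x = interpolate G L (\<lambda>v. g v v) x
    - (case x of Vertex v \<Rightarrow> 0 | Inner e s \<Rightarrow> rho e * s * (L e - s) / (L e)\<^sup>2)"
  using assms
proof (cases rule: points_cases)
  case (vertex v)
  then show ?thesis by (simp add: interpolate_def source_Green_def)
next
  case (inner e s)
  have L0: "L e \<noteq> 0" using inner by simp
  show ?thesis
    using Green_commute[of "tail G e" "head G e"] inner L0
    by (simp add: interpolate_def source_Green_def rho_def dipole_def grad_def power2_eq_square
        divide_simps) (simp add: algebra_simps)
qed

text \<open>Away from the ends of \<open>e\<close> and from \<open>y\<close>, the resistance is
  locally the quadratic polynomial \<open>Q\<close>.\<close>

lemma deriv_resistance:
  assumes y: "y \<in> points G L" and e: "e \<in> arcs G" and t: "0 < t" "t < L e" "y \<noteq> Inner e t"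
  shows "deriv (\<lambda>s. resistance G L (edge_point G L e s) y) t
    = 2 * grad G (source_Green y) e / L e - grad G (\<lambda>v. g v v) e / L e
      + (case y of Vertex v \<Rightarrow> 0 | Inner f p \<Rightarrow>
          if f = e then 2 * p / L e - (if t < p then 2 else 0) else 0)
      + (L e - rho e) / (L e)\<^sup>2 * (L e - 2 * t)"
    (is "_ = ?d")
proof (rule DERIV_imp_deriv)
  define slope where "slope = (case y of Vertex v \<Rightarrow> 0 | Inner f p \<Rightarrow>
          if f = e then (if t < p then 1 else 0) - p / L e else 0)"
  \<comment> \<open>The radius keeps the neighbourhood of \<open>t\<close> on one side of
    \<open>y\<close>; if \<open>y\<close> is not inside \<open>e\<close>, any positive value
    serves.\<close>
  define \<delta> where "\<delta> = (case y of Vertex v \<Rightarrow> 1 | Inner f p \<Rightarrow> if f = e then \<bar>t - p\<bar> else 1)"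
  define h where "h = bump L y e t - slope * t"
  define U where "U = ball t \<delta> \<inter> {0<..<L e}"
  have L0: "L e > 0" using t by simp
  have \<delta>: "\<delta> > 0" using t by (auto simp: \<delta>_def split: point.splits)
  have bump: "bump L y e s = h + slope * s" if "s \<in> U" for s
    using that \<delta> unfolding h_def bump_def slope_def \<delta>_def U_def
    by (auto simp: dist_real_def min_def abs_if algebra_simps split: point.splits if_splits)
  define Q where "Q = (\<lambda>s. g (tail G e) (tail G e) - grad G (\<lambda>v. g v v) e * s / L e
      - rho e * s * (L e - s) / (L e)\<^sup>2 + (s - s * s / L e)
      - 2 * (source_Green y (tail G e) - grad G (source_Green y) e * s / L e + (h + slope * s))
      + point_Green y y)"
  have res: "resistance G L (edge_point G L e s) y = Q s" if s: "s \<in> U" for s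
  proof -
    have s0: "0 < s" "s < L e" using s by (auto simp: U_def)
    then have ep: "edge_point G L e s = Inner e s" and x: "Inner e s \<in> points G L"
      using e by (auto simp: edge_point_def points_def)
    have "point_Green (Inner e s) (Inner e s) = g (tail G e) (tail G e) - grad G (\<lambda>v. g v v) e * s / L e
      - rho e * s * (L e - s) / (L e)\<^sup>2 + (s - s * s / L e)"
      unfolding point_Green_def source_Green_at_source[OF x] by (simp add: interpolate_def bump_def)
    moreover have "point_Green y (Inner e s)
      = source_Green y (tail G e) - grad G (source_Green y) e * s / L e + (h + slope * s)"
      using point_Green_edge_point[OF y e, of s] s0 ep bump[OF s] by simp
    ultimately show ?thesis
      unfolding ep resistance_eq[OF x y] Q_def by simp
  qed
  have "(Q has_real_derivative ?d) (at t)"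
  proof -
    have slope: "(case y of Vertex v \<Rightarrow> 0 | Inner f p \<Rightarrow>
          if f = e then 2 * p / L e - (if t < p then 2 else 0) else 0) = - 2 * slope"
      by (simp add: slope_def split: point.split)
    then have d: "?d = - (grad G (\<lambda>v. g v v) e / L e) - rho e * (L e - 2 * t) / (L e)\<^sup>2
        + (1 - 2 * t / L e) - 2 * (slope - grad G (source_Green y) e / L e)"
      unfolding slope using L0 by (simp add: field_simps power2_eq_square)
    show ?thesis
      unfolding d Q_def
      by (rule derivative_eq_intros refl | (use L0 in \<open>simp; fail\<close>))+
        (use L0 in \<open>simp add: field_simps power2_eq_square power4_eq_xxxx\<close>)
  qed
  moreover have "open U" "t \<in> U" using t \<delta> by (auto simp: U_def)
  ultimately show "((\<lambda>s. resistance G L (edge_point G L e s) y) has_real_derivative ?d) (at t)"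
    using res has_field_derivative_transform_within_open[of Q ?d t U] by auto
qed

text \<open>If \<open>y\<close> is not inside \<open>e\<close>, the constant part of the derivative
  is orthogonal to \<open>L e - 2 * t\<close>. Otherwise the integral is split at \<open>p\<close>,
  and the jump of the derivative by 2 produces the extra term.\<close>

lemma integral_deriv_resistance:
  assumes y: "y \<in> points G L" and e: "e \<in> arcs G"
  shows "integral {0..L e} (\<lambda>t. (deriv (\<lambda>s. resistance G L (edge_point G L e s) y) t)\<^sup>2)
    = (2 * grad G (source_Green y) e - grad G (\<lambda>v. g v v) e)\<^sup>2 / L e + (L e - rho e)\<^sup>2 / (3 * L e)
      + (case y of Vertex v \<Rightarrow> 0 | Inner f p \<Rightarrow>
          if f = e then 4 * rho e * p * (L e - p) / (L e)\<^sup>2 else 0)"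
proof -
  define c where "c = 2 * grad G (source_Green y) e / L e - grad G (\<lambda>v. g v v) e / L e"
  define B where "B = (L e - rho e) / (L e)\<^sup>2"
  define F where "F = (\<lambda>c s. c\<^sup>2 * s + 2 * c * B * (L e * s - s\<^sup>2)
      + B\<^sup>2 * ((L e)\<^sup>2 * s - 2 * L e * s\<^sup>2 + 4 * s ^ 3 / 3))"
  define D where "D = deriv (\<lambda>s. resistance G L (edge_point G L e s) y)"
  have L0: "L e > 0" using e by (rule length_pos)
  have cB: "2 * grad G (source_Green y) e - grad G (\<lambda>v. g v v) e = c * L e" "rho e = L e - B * (L e)\<^sup>2"
    using L0 by (simp_all add: c_def B_def field_simps)
  have D: "D t = c + (case y of Vertex v \<Rightarrow> 0 | Inner f p \<Rightarrow>
          if f = e then 2 * p / L e - (if t < p then 2 else 0) else 0) + B * (L e - 2 * t)"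
    if "0 < t" "t < L e" "y \<noteq> Inner e t" for t
    unfolding D_def c_def B_def by (rule deriv_resistance[OF y e that])
  show ?thesis
  proof (cases "\<exists>p. y = Inner e p")
    case False
    have "((\<lambda>t. (D t)\<^sup>2) has_integral F c (L e) - F c 0) {0..L e}"
      unfolding F_def
      by (rule has_integral_square_affine[of _ _ "{0, L e}"])
        (use L0 False D in \<open>auto split: point.splits\<close>)
    moreover have "F c (L e) - F c 0 = (c * L e)\<^sup>2 / L e + (B * (L e)\<^sup>2)\<^sup>2 / (3 * L e)"
      using L0 by (simp add: F_def field_simps power2_eq_square power3_eq_cube)
    ultimately show ?thesis
      using False unfolding cB D_def[symmetric]
      by (auto simp: integral_unique split: point.splits)
  next
    case True
    then obtain p where p: "y = Inner e p" by blast
    then have p0: "0 < p" "p < L e" using y by (auto simp: points_def)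
    let ?c1 = "c + (2 * p / L e - 2)" and ?c2 = "c + 2 * p / L e"
    have "((\<lambda>t. (D t)\<^sup>2) has_integral F ?c1 p - F ?c1 0) {0..p}"
      unfolding F_def
      by (rule has_integral_square_affine[of _ _ "{0, p}"]) (use p0 D p in auto)
    moreover have "((\<lambda>t. (D t)\<^sup>2) has_integral F ?c2 (L e) - F ?c2 p) {p..L e}"
      unfolding F_def
      by (rule has_integral_square_affine[of _ _ "{p, L e}"]) (use p0 D p in auto)
    ultimately have "((\<lambda>t. (D t)\<^sup>2) has_integral
        (F ?c1 p - F ?c1 0) + (F ?c2 (L e) - F ?c2 p)) {0..L e}"
      using p0 by (intro has_integral_combine[of 0 p]) auto
    moreover have "(F ?c1 p - F ?c1 0) + (F ?c2 (L e) - F ?c2 p)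
      = (c * L e)\<^sup>2 / L e + (B * (L e)\<^sup>2)\<^sup>2 / (3 * L e)
        + 4 * (L e - B * (L e)\<^sup>2) * p * (L e - p) / (L e)\<^sup>2"
      using L0 unfolding F_def by (simp add: field_simps power2_eq_square power3_eq_cube)
    ultimately show ?thesis
      unfolding cB D_def[symmetric] by (simp add: p integral_unique)
  qed
qed

lemma tau_at_eq:
  assumes y: "y \<in> points G L"
  shows "tau_at G L y = normalized_tau / 12"
proof -
  let ?k = "\<lambda>v. g v v"
  define extra where "extra = (\<lambda>e. case y of Vertex v \<Rightarrow> 0 | Inner f p \<Rightarrow>
          if f = e then 4 * rho e * p * (L e - p) / (L e)\<^sup>2 else 0)"
  have "(\<Sum>e\<in>arcs G. integral {0..L e} (\<lambda>t. (deriv (\<lambda>s. resistance G L (edge_point G L e s) y) t)\<^sup>2))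
    = (\<Sum>e\<in>arcs G. (3 * (grad G ?k e)\<^sup>2 + (L e - rho e)\<^sup>2) / L e / 3
        + 4 * (grad G (source_Green y) e * grad G (source_Green y) e / L e)
        - 4 * (grad G ?k e * grad G (source_Green y) e / L e) + extra e)"
  proof (intro sum.cong refl)
    fix e assume e: "e \<in> arcs G"
    have L0: "L e \<noteq> 0" using length_pos[OF e] by simp
    have extra: "(case y of Vertex v \<Rightarrow> 0 | Inner f p \<Rightarrow>
          if f = e then 4 * rho e * p * (L e - p) / (L e)\<^sup>2 else 0) = extra e"
      by (simp add: extra_def)
    show "integral {0..L e} (\<lambda>t. (deriv (\<lambda>s. resistance G L (edge_point G L e s) y) t)\<^sup>2)
      = (3 * (grad G ?k e)\<^sup>2 + (L e - rho e)\<^sup>2) / L e / 3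
        + 4 * (grad G (source_Green y) e * grad G (source_Green y) e / L e)
        - 4 * (grad G ?k e * grad G (source_Green y) e / L e) + extra e"
      unfolding integral_deriv_resistance[OF y e] extra using L0
      by (simp add: field_simps power2_eq_square)
  qed
  also have "\<dots> = normalized_tau / 3 + 4 * energy G L (source_Green y) (source_Green y)
      - 4 * energy G L ?k (source_Green y) + (\<Sum>e\<in>arcs G. extra e)"
    unfolding sum.distrib sum_subtractf sum_distrib_left[symmetric] sum_divide_distrib[symmetric]
    by (simp add: normalized_tau_def energy_def)
  also have "energy G L (source_Green y) (source_Green y) = interpolate G L (source_Green y) y"
    by (simp add: energy_source_Green source_Green_base y)
  also have "energy G L ?k (source_Green y) = interpolate G L ?k y"
    by (simp add: energy_source_Green y Green_base base_in_verts)
  \<comment> \<open>The jump terms are opposite to the two energy terms, so the dependence on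
    \<open>y\<close> disappears.\<close>
  also have "(\<Sum>e\<in>arcs G. extra e) = 4 * interpolate G L ?k y - 4 * interpolate G L (source_Green y) y"
    unfolding source_Green_at_source[OF y]
    using y by (cases rule: points_cases) (simp_all add: extra_def)
  finally show ?thesis
    by (simp add: tau_at_def)
qed

lemma tau_eq: "tau G L = normalized_tau / 12"
  unfolding tau_def
proof (rule tau_at_eq, rule someI)
  show "Vertex b \<in> points G L"
    using base_in_verts by (simp add: points_def)
qed

lemma z_invariant_eq:
  assumes "\<And>e. e \<in> arcs G \<Longrightarrow> network (del_arc e) L"
  shows "z_invariant G L = normalized_z"
  unfolding z_invariant_def normalized_z_def using assms edge_resistance_rho(2) by (intro sum.cong) auto

end

section \<open>Recursion for tau and z, and induction on the number of contractions\<close>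

text \<open>Bridgelessness enters only through the deleted graphs, which must again be networks.\<close>

locale bridgeless_network = network +
  assumes network_del_arc: "e \<in> arcs G \<Longrightarrow> network (del_arc e) L"
begin

text \<open>Deletion and contraction of different edges commute, so deleting after contracting gives
  a contraction of a deleted network.\<close>

lemma bridgeless_network_contract:
  assumes e: "e \<in> arcs G"
  shows "bridgeless_network (contract G e) L"
proof -
  interpret C: network "contract G e" L by (rule network_contract[OF e])
  show ?thesis
  proof (intro bridgeless_network.intro bridgeless_network_axioms.intro C.network_axioms)
    fix f assume "f \<in> arcs (contract G e)"
    then have f: "f \<in> arcs G" "e \<in> arcs (del_arc f)"
      using e by (auto simp: arcs_contract)
    then show "network (pre_digraph.del_arc (contract G e) f) L"
      unfolding contract_del_arc by (intro network.network_contract network_del_arc)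
  qed
qed

text \<open>The sums for the normalized invariants, translated back. \<open>contract_Green\<close>
  is the Green function of the contraction for nonloops; a loop has weight 0.\<close>

lemma contraction_identities:
  shows "(\<Sum>e\<in>arcs G. edge_resistance G L e / (L e + edge_resistance G L e) * tau (contract G e) L)
      = (real (card (verts G)) - 2) * tau G L + z_invariant G L / 12" (is ?tau)
    and "(\<Sum>e\<in>arcs G. edge_resistance G L e / (L e + edge_resistance G L e) * z_invariant (contract G e) L)
      = (real (card (verts G)) - 1) * z_invariant G L" (is ?z)
    and "e \<in> arcs G \<Longrightarrow> tail G e = head G e \<Longrightarrow> edge_resistance G L e / (L e + edge_resistance G L e) = 0"
proof -
  obtain b where "b \<in> verts G" using verts_nonempty by blast
  then obtain g where "grounded_network G L b g" by (rule obtain_grounded)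
  then interpret g: grounded_network G L b g .
  note p = g.edge_resistance_rho(1)[OF _ network_del_arc]
  show "e \<in> arcs G \<Longrightarrow> tail G e = head G e \<Longrightarrow> edge_resistance G L e / (L e + edge_resistance G L e) = 0"
    by (simp add: p g.rho_loop)
  have contracted: "g.rho e / L e * tau (contract G e) L
      = g.rho e / L e * (grounded_network.normalized_tau (contract G e) L (g.contract_Green e) / 12)"
    "g.rho e / L e * z_invariant (contract G e) L
      = g.rho e / L e * grounded_network.normalized_z (contract G e) L (g.contract_Green e)"
    if e: "e \<in> arcs G" for e
  proof -
    consider "g.rho e = 0" | "tail G e \<noteq> head G e"
      using g.rho_loop by blast
    then have "g.rho e = 0 \<or> tau (contract G e) L
        = grounded_network.normalized_tau (contract G e) L (g.contract_Green e) / 12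
      \<and> z_invariant (contract G e) L = grounded_network.normalized_z (contract G e) L (g.contract_Green e)"
    proof cases
      case 2
      interpret C: grounded_network "contract G e" L "if b = head G e then tail G e else b"
        "g.contract_Green e"
        by (rule g.grounded_network_contract[OF e 2])
      interpret B: bridgeless_network "contract G e" L by (rule bridgeless_network_contract[OF e])
      show ?thesis using C.tau_eq C.z_invariant_eq[OF B.network_del_arc] by simp
    qed simp
    then show "g.rho e / L e * tau (contract G e) L
        = g.rho e / L e * (grounded_network.normalized_tau (contract G e) L (g.contract_Green e) / 12)"
      "g.rho e / L e * z_invariant (contract G e) L
        = g.rho e / L e * grounded_network.normalized_z (contract G e) L (g.contract_Green e)"
      by (metis div_0 mult_zero_left)+
  qed
  have z: "z_invariant G L = g.normalized_z" by (rule g.z_invariant_eq[OF network_del_arc])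
  show ?z
    unfolding z g.sum_normalized_z_contract[symmetric]
    by (intro sum.cong refl) (simp only: p contracted)
  have "(\<Sum>e\<in>arcs G. edge_resistance G L e / (L e + edge_resistance G L e) * tau (contract G e) L)
    = (\<Sum>e\<in>arcs G. g.rho e / L e * grounded_network.normalized_tau (contract G e) L (g.contract_Green e)) / 12"
    unfolding sum_divide_distrib by (intro sum.cong refl) (simp only: p contracted times_divide_eq_right)
  then show ?tau
    unfolding z g.tau_eq g.sum_normalized_tau_contract by (simp add: add_divide_distrib)
qed

end

text \<open>The induction hypothesis is applied to every contraction of \<open>G\<close>; the
  identities for tau and z then evaluate the weighted sums.\<close>

lemma tau_eq_contraction_sum:
  assumes "bridgeless_network G L" "k + 2 \<le> card (verts G)"
  shows "tau G L = fact (card (verts G) - k - 2) / fact (card (verts G) - 2) * contraction_sum L k G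
    - real k * z_invariant G L / (12 * (real (card (verts G)) - real k - 1))"
  using assms
proof (induction k arbitrary: G)
  case 0
  then show ?case by simp
next
  case (Suc k)
  interpret bridgeless_network G L by fact
  define v where "v = card (verts G)"
  define p where "p = (\<lambda>e. edge_resistance G L e / (L e + edge_resistance G L e))"
  define F :: real where "F = fact (v - 1 - k - 2)"
  define F' :: real where "F' = fact (v - 1 - 2)"
  define Z where "Z = z_invariant G L"
  define S where "S = contraction_sum L (Suc k) G"
  have v: "k + 3 \<le> v" using Suc.prems by (simp add: v_def)
  have pos: "F' > 0" by (simp add: F'_def)
  have step: "p e * tau (contract G e) L = F / F' * (p e * contraction_sum L k (contract G e))
      - real k / (12 * (real v - real k - 2)) * (p e * z_invariant (contract G e) L)"
    if e: "e \<in> arcs G" for e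
  proof (cases "tail G e = head G e")
    \<comment> \<open>Contracting a loop keeps the number of vertices, so the hypothesis would carry
      the wrong coefficients, but the weight is 0.\<close>
    case True
    then have "p e = 0" using contraction_identities(3)[OF e] by (simp add: p_def)
    then show ?thesis by simp
  next
    case False
    have card: "card (verts (contract G e)) = v - 1"
      using card_verts_contract[OF e False] by (simp add: v_def)
    have "tau (contract G e) L = F / F' * contraction_sum L k (contract G e)
      - real k * z_invariant (contract G e) L / (12 * (real (v - 1) - real k - 1))"
      using Suc.IH[OF bridgeless_network_contract[OF e]] v unfolding card F_def F'_def by simp
    moreover have "real (v - 1) - real k - 1 = real v - real k - 2" using v by simp
    ultimately show ?thesis by (simp add: right_diff_distrib mult.left_commute)
  qed
  have "(real v - 2) * tau G L + Z / 12 = (\<Sum>e\<in>arcs G. p e * tau (contract G e) L)"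
    using contraction_identities(1) by (simp add: p_def v_def Z_def)
  also have "\<dots> = F / F' * S - real k / (12 * (real v - real k - 2)) * ((real v - 1) * Z)"
    unfolding S_def contraction_sum.simps Z_def v_def contraction_identities(2)[symmetric]
    using step by (simp add: p_def v_def sum_subtractf sum_distrib_left)
  finally have eq: "(real v - 2) * tau G L
      = F / F' * S - real k / (12 * (real v - real k - 2)) * ((real v - 1) * Z) - Z / 12"
    by simp
  have pos': "real v - 2 > 0" "real v - real k - 2 > 0" using v by simp_all
  \<comment> \<open>Since \<open>k + 3 \<le> v\<close>, the natural subtractions are exact and
    \<open>v - 2\<close> is the successor of \<open>v - 1 - 2\<close>.\<close>
  have fact_v: "fact (v - 2) = (real v - 2) * F'"
  proof -
    have "v - 2 = Suc (v - 1 - 2)" "real (Suc (v - 1 - 2)) = real v - 2" using v by auto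
    then show ?thesis unfolding F'_def by (simp only: fact_Suc)
  qed
  have "tau G L = ((real v - 2) * tau G L) / (real v - 2)" using pos' by simp
  \<comment> \<open>The coefficients of \<open>Z\<close> combine by \<open>1 + k * (v - 1) / (v - k
    - 2) = (k + 1) * (v - 2) / (v - k - 2)\<close>.\<close>
  also have "\<dots> = F / ((real v - 2) * F') * S - real (Suc k) * Z / (12 * (real v - real (Suc k) - 1))"
    unfolding eq using pos pos' by (simp add: divide_simps) (simp add: algebra_simps)
  finally show ?case
    unfolding v_def[symmetric] Z_def[symmetric] S_def[symmetric] fact_v
    by (simp add: F_def)
qed

theorem theorem5p7:
  fixes G :: "('a, 'b) pre_digraph" and L :: "'b \<Rightarrow> real" and k v :: nat
  assumes "metrized_graph G L"
    and "bridgeless G"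
    and "v = card (verts G)"
    and "k \<ge> 1"
    and "k + 2 \<le> v"
  shows "tau G L =
    fact (v - k - 2) / fact (v - 2) * contraction_sum L k G
    - real k * z_invariant G L / (12 * (real v - real k - 1))"
proof -
  interpret metrized_graph G L by fact
  interpret network G L by (rule network)
  have "bridgeless_network G L"
    using \<open>bridgeless G\<close> network_del_arc
    by (intro bridgeless_network.intro bridgeless_network_axioms.intro network_axioms)
      (auto simp: bridgeless_def)
  then show ?thesis
    using tau_eq_contraction_sum[of G L k] assms by simp
qed

end
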